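(* Let $(\mathcal{V},\circ,\langle\cdot,\cdot\rangle)$ be a Euclidean Jordan algebra of rank $n$, and let $p,r,s\in[1,\infty]$ with $\frac1p=\frac1r+\frac1s$. Then the following statements hold for all $a,b\in\mathcal{V}$: (i) $$\|a\circ b\|_p\leq\|a\|_r\,\|b\|_s\quad\text{and}\quad\|L_a\|_{r\to s}=\begin{cases}\|a\|_\infty & \text{if } r\leq s,\\ \|a\|_{\frac{rs}{r-s}} & \text{if } s<r.\end{cases}$$ (ii) $$\|P_a(b)\|_p\leq\|a^2\|_r\,\|b\|_s\quad\text{and}\quad\|P_a\|_{r\to s}=\begin{cases}\|a^2\|_\infty & \text{if } r\leq s,\\ \|a^2\|_{\frac{rs}{r-s}} & \text{if } s<r.\end{cases}$$
   Context: A Euclidean Jordan algebra $(\mathcal{V},\circ,\langle\cdot,\cdot\rangle)$ is a finite-dimensional real inner product space with a commutative bilinear product $\circ$ satisfying $x\circ(x^2\circ y)=x^2\circ(x\circ y)$ and $\langle x\circ y,z\rangle=\langle y,x\circ z\rangle$ (where $x^2=x\circ x$), with unit element $e$. A Jordan frame is a set $\{e_1,\dots,e_n\}$ of primitive idempotents with $e_i\circ e_j=0$ for $i\neq j$ and $\sum_i e_i=e$; the number $n$ is the rank of $\mathcal{V}$. Every $x\in\mathcal{V}$ has a spectral decomposition $x=x_1e_1+\cdots+x_ne_n$ for some Jordan frame, with the real numbers $x_i$ (the eigenvalues of $x$) uniquely determined up to order. $\lambda(x)\in\mathbb{R}^n$ denotes the vector of eigenvalues of $x$ in decreasing order. The inner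 product is the trace inner product $\langle x,y\rangle=\operatorname{tr}(x\circ y)$, where $\operatorname{tr}$ is the sum of eigenvalues. The Lyapunov transformation and the quadratic representation of $a\in\mathcal{V}$ are the linear maps $L_a(x):=a\circ x$ and $P_a(x):=2\,a\circ(a\circ x)-a^2\circ x$ on $\mathcal{V}$. Norms: for $p\in[1,\infty]$, $\|x\|_p:=\|\lambda(x)\|_p$ is the spectral $p$-norm on $\mathcal{V}$, the right side being the usual $p$-norm on $\mathbb{R}^n$. For a linear $T:\mathcal{V}\to\mathcal{V}$, $\|T\|_{r\to s}:=\sup_{0\neq x\in\mathcal{V}}\frac{\|T(x)\|_s}{\|x\|_r}$. Conventions: $\frac1\infty=0$; for $s<r$ the exponent $\frac{rs}{r-s}$ is the number $t$ with $\frac1s=\frac1t+\frac1r$, so it equals $s$ when $r=\infty$. *)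

theory Defs
  imports "HOL-Analysis.Analysis" "HOL-Library.Extended_Real"
begin

text \<open>
  The underlying finite-dimensional real inner product space is a type of class
  \<^class>\<open>euclidean_space\<close>, with \<^const>\<open>inner\<close> as inner product; such a space has
  positive dimension, so the zero algebra is excluded. Jordan product and unit are
  explicit parameters.
\<close>

locale euclidean_jordan_algebra =
  fixes jprod :: "'a::euclidean_space \<Rightarrow> 'a \<Rightarrow> 'a" (infixl "\<odot>" 70)
    and e :: 'a
  assumes bilinear_jprod: "bilinear (\<odot>)"
    and jprod_commute: "x \<odot> y = y \<odot> x"
    and jordan_identity: "x \<odot> ((x \<odot> x) \<odot> y) = (x \<odot> x) \<odot> (x \<odot> y)"
    and inner_jprod: "inner (x \<odot> y) z = inner y (x \<odot> z)"
    and unit_jprod: "e \<odot> x = x"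

context
  fixes jprod :: "'a::euclidean_space \<Rightarrow> 'a \<Rightarrow> 'a" (infixl "\<odot>" 70)
    and e :: 'a
begin

definition jordan_idempotent :: "'a \<Rightarrow> bool" where
  "jordan_idempotent c \<longleftrightarrow> c \<odot> c = c"

definition primitive_idempotent :: "'a \<Rightarrow> bool" where
  "primitive_idempotent c \<longleftrightarrow> jordan_idempotent c \<and> c \<noteq> 0 \<and>
     \<not> (\<exists>c1 c2. jordan_idempotent c1 \<and> c1 \<noteq> 0 \<and>
                 jordan_idempotent c2 \<and> c2 \<noteq> 0 \<and> c = c1 + c2)"

definition jordan_frame :: "'a set \<Rightarrow> bool" where
  "jordan_frame F \<longleftrightarrow> finite F \<and> (\<forall>c\<in>F. primitive_idempotent c) \<and>
     (\<forall>c\<in>F. \<forall>d\<in>F. c \<noteq> d \<longrightarrow> c \<odot> d = 0) \<and> \<Sum>F = e"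

definition jordan_rank :: nat where
  "jordan_rank = (THE n. \<exists>F. jordan_frame F \<and> card F = n)"

definition spectral_decomposition :: "'a \<Rightarrow> real list \<Rightarrow> 'a list \<Rightarrow> bool" where
  "spectral_decomposition x xs es \<longleftrightarrow>
     distinct es \<and> jordan_frame (set es) \<and> length xs = length es \<and>
     x = (\<Sum>i<length es. (xs ! i) *\<^sub>R (es ! i))"

text \<open>The vector $\lambda(x)$: the eigenvalues, with multiplicity, in decreasing order.\<close>

definition eigenvalues :: "'a \<Rightarrow> real list" where
  "eigenvalues x = (THE xs. sorted_wrt (\<ge>) xs \<and> (\<exists>es. spectral_decomposition x xs es))"

definition jordan_trace :: "'a \<Rightarrow> real" where
  "jordan_trace x = sum_list (eigenvalues x)"

definition lyapunov :: "'a \<Rightarrow> 'a \<Rightarrow> 'a" where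
  "lyapunov a x = a \<odot> x"

definition quadratic_rep :: "'a \<Rightarrow> 'a \<Rightarrow> 'a" where
  "quadratic_rep a x = 2 *\<^sub>R (a \<odot> (a \<odot> x)) - (a \<odot> a) \<odot> x"

end

text \<open>The $p$-norm on $\mathbb{R}^n$, $n \ge 1$, for $p \in [1,\infty]$.\<close>

definition lp_norm :: "ereal \<Rightarrow> real list \<Rightarrow> real" where
  "lp_norm p xs =
     (if p = \<infinity> then Max ((\<lambda>t. \<bar>t\<bar>) ` set xs)
      else (\<Sum>t\<leftarrow>xs. \<bar>t\<bar> powr real_of_ereal p) powr (1 / real_of_ereal p))"

definition spectral_norm ::
  "('a::euclidean_space \<Rightarrow> 'a \<Rightarrow> 'a) \<Rightarrow> 'a \<Rightarrow> ereal \<Rightarrow> 'a \<Rightarrow> real" where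
  "spectral_norm jprod e p x = lp_norm p (eigenvalues jprod e x)"

text \<open>
  The supremum is taken in the extended reals, so that equality with a real number
  includes boundedness of the set of quotients.
\<close>

definition spectral_op_norm ::
  "('a::euclidean_space \<Rightarrow> 'a \<Rightarrow> 'a) \<Rightarrow> 'a \<Rightarrow> ereal \<Rightarrow> ereal \<Rightarrow> ('a \<Rightarrow> 'a) \<Rightarrow> ereal" where
  "spectral_op_norm jprod e r s T =
     (SUP x\<in>{x. x \<noteq> 0}. ereal (spectral_norm jprod e s (T x) / spectral_norm jprod e r x))"

text \<open>
  The exponent $rs/(r-s)$ for $s < r$, i.e. the $t$ with $1/s = 1/t + 1/r$;
  $r = \infty$ has to be treated separately in \<^typ>\<open>ereal\<close> arithmetic.
\<close>

definition quotient_exponent :: "ereal \<Rightarrow> ereal \<Rightarrow> ereal" where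
  "quotient_exponent r s = (if r = \<infinity> then s else r * s / (r - s))"

end

theory Submission
  imports Defs
begin

text \<open>
  Write \<open>P\<^bsub>a,b\<^esub>\<close> for the polarisation of the quadratic representation, so that
  \<open>P\<^bsub>a,a\<^esub> = P\<^sub>a\<close> and \<open>P\<^bsub>a,e\<^esub> = L\<^sub>a\<close>. Both parts follow from the inequality
  \<open>\<bar>\<langle>P\<^bsub>a,b\<^esub> x, y\<rangle>\<bar> \<le> \<Sum>\<^sub>i A\<^sub>i B\<^sub>i X\<^sub>i Y\<^sub>i\<close> in the decreasingly ordered moduli of the eigenvalues of the four
  arguments, combined with \<open>\<ell>\<^sub>p\<close> duality and the classical Hoelder inequality; the operator norms
  are attained at elements of the frame of \<open>a\<close>.

  Both sides of the inequality are additive over the layer decomposition (Abel summation) of each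
  argument, so it suffices that \<open>\<bar>\<langle>P\<^bsub>a,b\<^esub> x, y\<rangle>\<bar> \<le> min(j,k,l,m)\<close> for arguments with spectral
  \<open>\<infinity>\<close>-norm at most 1 and 1-norms at most \<open>j, k, l, m\<close>. The form is symmetric enough that only the
  bound by \<open>m\<close> is needed, which reduces to \<open>y\<close> a primitive idempotent. There it follows from the
  positivity of \<open>\<langle>P\<^sub>a f, y\<rangle>\<close> for primitive \<open>f\<close>, by the arithmetic-geometric mean inequality for the
  positive semidefinite form \<open>(a, b) \<mapsto> \<langle>P\<^bsub>a,b\<^esub> f, y\<rangle>\<close>, summed over the frame of \<open>x\<close>.
\<close>


section \<open>Norms of finite families\<close>

text \<open>The index set is arbitrary, so that the same norm serves for coefficients indexed by a
  Jordan frame and for sequences indexed by the numbers below the rank.\<close>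

definition lp :: "ereal \<Rightarrow> 'i set \<Rightarrow> ('i \<Rightarrow> real) \<Rightarrow> real" where
  "lp p I f = (if p = \<infinity> then Max ((\<lambda>i. \<bar>f i\<bar>) ` I)
     else (\<Sum>i\<in>I. \<bar>f i\<bar> powr real_of_ereal p) powr (1 / real_of_ereal p))"

lemma lp_norm_eq_lp:
  assumes "mset xs = image_mset f (mset_set I)" "finite I"
  shows "lp_norm p xs = lp p I f"
proof -
  have "set xs = f ` I" using assms by (metis finite_set_mset_mset_set set_image_mset set_mset_mset)
  moreover have "(\<Sum>t\<leftarrow>xs. g t) = (\<Sum>i\<in>I. g (f i))" for g :: "real \<Rightarrow> real"
  proof -
    have "(\<Sum>t\<leftarrow>xs. g t) = \<Sum>\<^sub># (image_mset g (mset xs))" by (simp add: sum_mset_sum_list flip: mset_map)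
    then show ?thesis unfolding assms(1) by (simp add: image_mset.compositionality sum_unfold_sum_mset comp_def)
  qed
  ultimately show ?thesis by (simp add: lp_norm_def lp_def image_image)
qed

lemma lp_bij_betw:
  assumes "bij_betw h J I" "\<And>j. j \<in> J \<Longrightarrow> \<bar>g j\<bar> = \<bar>f (h j)\<bar>"
  shows "lp p I f = lp p J g"
proof -
  have "(\<lambda>i. \<bar>f i\<bar>) ` I = (\<lambda>j. \<bar>g j\<bar>) ` J"
    using assms by (force simp: bij_betw_def)
  moreover have "(\<Sum>i\<in>I. \<bar>f i\<bar> powr t) = (\<Sum>j\<in>J. \<bar>g j\<bar> powr t)" for t
    using assms(2) by (subst sum.reindex_bij_betw[OF assms(1), symmetric]) (auto intro!: sum.cong)
  ultimately show ?thesis by (simp add: lp_def)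
qed

lemma lp_nonneg:
  assumes "finite I" "I \<noteq> {}"
  shows "0 \<le> lp p I f"
proof -
  obtain i where "i \<in> I" using assms by blast
  then have "\<bar>f i\<bar> \<le> Max ((\<lambda>i. \<bar>f i\<bar>) ` I)" using assms by (intro Max_ge) auto
  then have "0 \<le> Max ((\<lambda>i. \<bar>f i\<bar>) ` I)" by (rule order_trans[OF abs_ge_zero])
  then show ?thesis by (simp add: lp_def)
qed

lemma lp_cong: "(\<And>i. i \<in> I \<Longrightarrow> \<bar>f i\<bar> = \<bar>g i\<bar>) \<Longrightarrow> lp p I f = lp p I g"
  by (rule lp_bij_betw[of "\<lambda>x. x"]) (auto simp: bij_betw_def)

lemma le_lp_infinity: "finite I \<Longrightarrow> i \<in> I \<Longrightarrow> \<bar>f i\<bar> \<le> lp \<infinity> I f"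
  by (auto simp: lp_def)

lemma lp_infinity_le: "finite I \<Longrightarrow> I \<noteq> {} \<Longrightarrow> (\<And>i. i \<in> I \<Longrightarrow> \<bar>f i\<bar> \<le> c) \<Longrightarrow> lp \<infinity> I f \<le> c"
  by (auto simp: lp_def)

lemma lp_real: "lp (ereal p) I f = (\<Sum>i\<in>I. \<bar>f i\<bar> powr p) powr (1 / p)"
  by (simp add: lp_def)

lemma lp_real_powr:
  assumes "0 < p"
  shows "lp (ereal p) I f powr p = (\<Sum>i\<in>I. \<bar>f i\<bar> powr p)"
  using assms by (simp add: lp_real powr_powr sum_nonneg)

lemma lp_mult_left:
  assumes "finite I" "I \<noteq> {}" "1 \<le> p"
  shows "lp p I (\<lambda>i. f i * g i) \<le> lp \<infinity> I f * lp p I g"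
proof (cases p)
  case (real q)
  have M: "0 \<le> lp \<infinity> I f" using lp_nonneg assms by blast
  have q: "q \<ge> 1" using assms real by simp
  have "(\<Sum>i\<in>I. \<bar>f i * g i\<bar> powr q) \<le> (\<Sum>i\<in>I. lp \<infinity> I f powr q * \<bar>g i\<bar> powr q)"
    using q by (intro sum_mono) (auto simp: abs_mult powr_mult[symmetric] intro!: powr_mono2 mult_right_mono le_lp_infinity assms)
  then have "(\<Sum>i\<in>I. \<bar>f i * g i\<bar> powr q) powr (1/q) \<le> (lp \<infinity> I f powr q * (\<Sum>i\<in>I. \<bar>g i\<bar> powr q)) powr (1/q)"
    using q by (intro powr_mono2) (auto simp: sum_distrib_left sum_nonneg)
  also have "\<dots> = lp \<infinity> I f * lp p I g"
    using q M by (simp add: real lp_real powr_mult powr_powr)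
  finally show ?thesis by (simp add: real lp_real)
next
  case PInf
  show ?thesis unfolding PInf
  proof (rule lp_infinity_le[OF assms(1,2)])
    fix i assume "i \<in> I"
    then show "\<bar>f i * g i\<bar> \<le> lp \<infinity> I f * lp \<infinity> I g"
      unfolding abs_mult using assms by (intro mult_mono le_lp_infinity lp_nonneg) auto
  qed
qed (use assms in auto)

lemma lp_mult_right:
  assumes "finite I" "I \<noteq> {}" "1 \<le> p"
  shows "lp p I (\<lambda>i. f i * g i) \<le> lp p I f * lp \<infinity> I g"
  using lp_mult_left[OF assms, of g f] by (simp add: mult.commute)

text \<open>After normalising by the power sums \<open>S\<close> and \<open>T\<close>, Young's
  inequality applies to each term, with weights \<open>p/r\<close> and \<open>p/s\<close> that add
  up to 1 by the relation between the exponents. If \<open>S\<close> or \<open>T\<close> is zero, so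
  is the left side.\<close>

lemma lp_Holder_real:
  assumes I: "finite I" and pos: "0 < p" "0 < r" "0 < s" and prs: "1 / p = 1 / r + 1 / s"
  shows "lp (ereal p) I (\<lambda>i. f i * g i) \<le> lp (ereal r) I f * lp (ereal s) I g"
proof -
  define S where "S = (\<Sum>i\<in>I. \<bar>f i\<bar> powr r)"
  define T where "T = (\<Sum>i\<in>I. \<bar>g i\<bar> powr s)"
  have ST: "0 \<le> S" "0 \<le> T" by (auto simp: S_def T_def sum_nonneg)
  show ?thesis
  proof (cases "S = 0 \<or> T = 0")
    case True
    then have "\<forall>i\<in>I. f i * g i = 0"
      using I by (auto simp: S_def T_def sum_nonneg_eq_0_iff)
    then have "(\<Sum>i\<in>I. \<bar>f i * g i\<bar> powr p) = 0" by (intro sum.neutral) auto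
    then have "lp (ereal p) I (\<lambda>i. f i * g i) = 0" by (simp add: lp_real)
    then show ?thesis by (simp add: lp_real)
  next
    case False
    then have STp: "0 < S" "0 < T" using ST by auto
    have conj: "p / r + p / s = 1" 
    proof -
      have "p * (1 / p) = p * (1 / r + 1 / s)" using prs by simp
      then show ?thesis using pos by (simp add: distrib_left)
    qed
    have termwise: "\<bar>f i * g i\<bar> powr p \<le> S powr (p/r) * T powr (p/s) *
        (p/r * (\<bar>f i\<bar> powr r / S) + p/s * (\<bar>g i\<bar> powr s / T))" for i
    proof (cases "f i = 0 \<or> g i = 0")
      case True
      then show ?thesis using pos STp by (auto intro!: mult_nonneg_nonneg add_nonneg_nonneg divide_nonneg_nonneg)
    next
      case nz: False
      have "(\<bar>f i\<bar> powr r / S) powr (p/r) * (\<bar>g i\<bar> powr s / T) powr (p/s)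
          \<le> p/r * (\<bar>f i\<bar> powr r / S) + p/s * (\<bar>g i\<bar> powr s / T)"
        using nz STp pos conj by (intro Youngs_inequality_0) auto
      then have "S powr (p/r) * T powr (p/s) * ((\<bar>f i\<bar> powr r / S) powr (p/r) * (\<bar>g i\<bar> powr s / T) powr (p/s))
          \<le> S powr (p/r) * T powr (p/s) * (p/r * (\<bar>f i\<bar> powr r / S) + p/s * (\<bar>g i\<bar> powr s / T))"
        by (intro mult_left_mono) auto
      moreover have "S powr (p/r) * T powr (p/s) * ((\<bar>f i\<bar> powr r / S) powr (p/r) * (\<bar>g i\<bar> powr s / T) powr (p/s))
          = \<bar>f i * g i\<bar> powr p"
        using STp pos by (simp add: powr_divide powr_powr powr_mult abs_mult)
      ultimately show ?thesis by simp
    qed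
    have "(\<Sum>i\<in>I. \<bar>f i * g i\<bar> powr p) \<le> (\<Sum>i\<in>I. S powr (p/r) * T powr (p/s) *
        (p/r * (\<bar>f i\<bar> powr r / S) + p/s * (\<bar>g i\<bar> powr s / T)))"
      by (rule sum_mono) (rule termwise)
    also have "\<dots> = S powr (p/r) * T powr (p/s) * (p/r * (S / S) + p/s * (T / T))"
      unfolding S_def T_def by (simp only: sum_distrib_left[symmetric] sum.distrib sum_divide_distrib[symmetric])
    also have "\<dots> = S powr (p/r) * T powr (p/s)" using STp conj by simp
    finally have "(\<Sum>i\<in>I. \<bar>f i * g i\<bar> powr p) powr (1/p) \<le> (S powr (p/r) * T powr (p/s)) powr (1/p)"
      using pos by (intro powr_mono2) (auto simp: sum_nonneg)
    also have "\<dots> = S powr (1/r) * T powr (1/s)"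
      using pos by (simp add: powr_mult powr_powr)
    finally show ?thesis by (simp add: lp_real S_def T_def)
  qed
qed

text \<open>If \<open>r\<close> or \<open>s\<close> is infinite, its reciprocal is 0 and
  \<open>p\<close> equals the other exponent; otherwise all three exponents are real.\<close>

lemma lp_Holder:
  assumes I: "finite I" "I \<noteq> {}" and ge1: "1 \<le> p" "1 \<le> r" "1 \<le> s" and prs: "1 / p = 1 / r + 1 / s"
  shows "lp p I (\<lambda>i. f i * g i) \<le> lp r I f * lp s I g"
proof -
  consider "r = \<infinity>" | "s = \<infinity>" | r' s' where "r = ereal r'" "s = ereal s'" "1 \<le> r'" "1 \<le> s'"
    using ge1 by (cases r; cases s) auto
  then show ?thesis
  proof cases
    case 1
    then have "p = s" using prs ge1 by (cases p; cases s) (auto simp: one_ereal_def)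
    then show ?thesis using 1 lp_mult_left I ge1 by metis
  next
    case 2
    then have "p = r" using prs ge1 by (cases p; cases r) (auto simp: one_ereal_def)
    then show ?thesis using 2 lp_mult_right I ge1 by metis
  next
    case 3
    then have rs: "1 / r + 1 / s = ereal (1 / r' + 1 / s')" by (simp add: one_ereal_def)
    have "0 < 1 / r' + 1 / s'" using 3 by (intro add_pos_pos) auto
    then obtain p' where p': "p = ereal p'" "1 \<le> p'" using prs rs ge1 by (cases p) auto
    have "1 / p' = 1 / r' + 1 / s'" using prs rs p' by (simp add: one_ereal_def)
    then show ?thesis using lp_Holder_real[OF I(1), of p' r' s' f g] 3 p' by simp
  qed
qed

text \<open>Every modulus is at most the \<open>r\<close>-norm \<open>N\<close>, so a power with
  exponent \<open>s'\<close> is at most \<open>N powr (s' - r')\<close> times the power with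
  exponent \<open>r'\<close>; these bounds sum to \<open>N powr s'\<close>.\<close>

lemma lp_antimono:
  assumes I: "finite I" "I \<noteq> {}" and "1 \<le> r" "r \<le> s"
  shows "lp s I f \<le> lp r I f"
proof (cases r)
  case (real r')
  have r': "1 \<le> r'" using assms real by simp
  define N where "N = lp r I f"
  have N: "0 \<le> N" using lp_nonneg[OF I] by (simp add: N_def)
  have Nr: "N powr r' = (\<Sum>i\<in>I. \<bar>f i\<bar> powr r')" using lp_real_powr[of r' I f] r' by (simp add: N_def real)
  have le: "\<bar>f i\<bar> \<le> N" if "i \<in> I" for i
  proof -
    have "\<bar>f i\<bar> powr r' \<le> N powr r'"
      unfolding Nr by (rule member_le_sum[OF that]) (auto simp: I)
    then show ?thesis using r' N powr_less_mono2[of r' N "\<bar>f i\<bar>"] by linarith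
  qed
  show ?thesis
  proof (cases s)
    case PInf
    then show ?thesis using lp_infinity_le[OF I] le by (simp add: N_def)
  next
    case (real s')
    have s': "r' \<le> s'" using assms real \<open>r = ereal r'\<close> by simp
    have "(\<Sum>i\<in>I. \<bar>f i\<bar> powr s') \<le> (\<Sum>i\<in>I. N powr (s' - r') * \<bar>f i\<bar> powr r')"
    proof (rule sum_mono)
      fix i assume "i \<in> I"
      then have "\<bar>f i\<bar> powr (s' - r') * \<bar>f i\<bar> powr r' \<le> N powr (s' - r') * \<bar>f i\<bar> powr r'"
        using le s' by (intro mult_right_mono powr_mono2) auto
      then show "\<bar>f i\<bar> powr s' \<le> N powr (s' - r') * \<bar>f i\<bar> powr r'"
        by (simp flip: powr_add)
    qed
    also have "\<dots> = N powr s'" by (simp add: sum_distrib_left[symmetric] Nr[symmetric] flip: powr_add)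
    finally have "(\<Sum>i\<in>I. \<bar>f i\<bar> powr s') powr (1/s') \<le> (N powr s') powr (1/s')"
      using s' r' by (intro powr_mono2) (auto simp: sum_nonneg)
    then show ?thesis using s' r' N by (simp add: real lp_real powr_powr N_def)
  next
    case MInf
    then show ?thesis using assms by simp
  qed
next
  case PInf
  then show ?thesis using assms by simp
qed (use assms in auto)

lemma lp_zero: "finite I \<Longrightarrow> I \<noteq> {} \<Longrightarrow> (\<And>i. i \<in> I \<Longrightarrow> f i = 0) \<Longrightarrow> lp p I f = 0"
proof -
  assume I: "finite I" "I \<noteq> {}" and f: "\<And>i. i \<in> I \<Longrightarrow> f i = 0"
  then have "lp p I f = lp p I (\<lambda>_. 0)" by (intro lp_cong) simp
  also have "\<dots> = 0" using I by (simp add: lp_def)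
  finally show ?thesis .
qed

lemma lp_single:
  assumes "finite I" "d \<in> I" "1 \<le> p"
  shows "lp p I (\<lambda>i. if i = d then k else 0) = \<bar>k\<bar>"
proof (cases p)
  case (real q)
  have "(\<Sum>i\<in>I. \<bar>if i = d then k else 0\<bar> powr q) = (\<Sum>i\<in>I. if i = d then \<bar>k\<bar> powr q else 0)"
    by (intro sum.cong) auto
  then show ?thesis using assms real by (simp add: lp_real powr_powr)
next
  case PInf
  have "Max ((\<lambda>i. \<bar>if i = d then k else 0\<bar>) ` I) = \<bar>k\<bar>"
    by (rule Max_eqI) (use assms in auto)
  then show ?thesis by (simp add: PInf lp_def)
qed (use assms in auto)

section \<open>Jordan identities, idempotents and the spectral theorem\<close>

text \<open>A maximiser \<open>w\<close> of the Rayleigh quotient on the unit sphere of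
  \<open>W\<close>. The form \<open>B\<close> is positive semidefinite on \<open>W\<close> and
  vanishes at \<open>w\<close>, so \<open>w\<close> lies in its radical; pairing \<open>w\<close>
  with \<open>\<mu> *\<^sub>R w - f w\<close> shows that this vector is zero.\<close>

lemma symmetric_eigenvector:
  fixes f :: "'a::euclidean_space \<Rightarrow> 'a"
  assumes "linear f" "subspace W" "W \<noteq> {0}" "\<And>w. w \<in> W \<Longrightarrow> f w \<in> W"
    and sym: "\<And>v w. v \<in> W \<Longrightarrow> w \<in> W \<Longrightarrow> inner (f v) w = inner v (f w)"
  obtains w \<mu> where "w \<in> W" "w \<noteq> 0" "f w = \<mu> *\<^sub>R w"
proof -
  interpret f: linear f by fact
  have W: "0 \<in> W" "\<And>x y. x \<in> W \<Longrightarrow> y \<in> W \<Longrightarrow> x + y \<in> W" "\<And>k x. x \<in> W \<Longrightarrow> k *\<^sub>R x \<in> W"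
    using assms(2) by (auto simp: subspace_def)
  let ?S = "W \<inter> sphere 0 1"
  obtain w0 where w0: "w0 \<in> W" "w0 \<noteq> 0" using assms(3) W(1) by blast
  have "compact ?S"
    using closed_subspace[OF assms(2)] compact_sphere closed_Int_compact by blast
  moreover have "(1 / norm w0) *\<^sub>R w0 \<in> ?S" using w0 W by simp
  then have "?S \<noteq> {}" by blast
  moreover have "continuous_on ?S (\<lambda>w. inner (f w) w)"
    using linear_continuous_on[OF linear_linear[THEN iffD2, OF assms(1)]]
    by (intro continuous_intros)
  ultimately obtain w where w: "w \<in> ?S" and max: "\<And>v. v \<in> ?S \<Longrightarrow> inner (f v) v \<le> inner (f w) w"
    using continuous_attains_sup[of ?S "\<lambda>w. inner (f w) w"] by blast
  define \<mu> where "\<mu> = inner (f w) w"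
  define B where "B u v = \<mu> * inner u v - inner (f u) v" for u v
  have wW: "w \<in> W" and ww: "inner w w = 1" using w by (auto simp: norm_eq_1)
  have B_nonneg: "0 \<le> B v v" if "v \<in> W" for v
  proof (cases "v = 0")
    case False
    let ?v = "(1 / norm v) *\<^sub>R v"
    have "?v \<in> ?S" using False that W by simp
    then have "inner (f ?v) ?v \<le> \<mu>" using max \<mu>_def by blast
    then have "inner (f v) v / (norm v)\<^sup>2 \<le> \<mu>"
      by (simp add: f.scaleR power2_eq_square)
    then have "inner (f v) v \<le> \<mu> * (norm v)\<^sup>2"
      using False by (simp add: field_simps)
    then show ?thesis by (simp add: B_def power2_norm_eq_inner)
  qed (simp add: B_def f.zero)
  have "B w z = 0" if z: "z \<in> W" for z
  proof -
    have ex: "B (w + t *\<^sub>R z) (w + t *\<^sub>R z) = t\<^sup>2 * B z z + 2 * t * B w z" for t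
    proof -
      have "inner (f z) w = inner (f w) z" using sym[OF wW z] by (simp add: inner_commute)
      then show ?thesis
        using ww by (simp add: B_def f.add f.scaleR inner_add_left inner_add_right \<mu>_def
          inner_commute[of z w] algebra_simps power2_eq_square)
    qed
    have *: "0 \<le> t\<^sup>2 * B z z + 2 * t * B w z" for t
      using B_nonneg[of "w + t *\<^sub>R z"] wW z W ex by simp
    \<comment> \<open>The nonnegative quadratic in \<open>t\<close> is evaluated close to its
      minimiser; the summand 1 keeps the denominator positive when \<open>B z z = 0\<close>.\<close>
    let ?k = "1 + B z z"
    have k: "?k > 0" using B_nonneg[OF z] by simp
    have "(- B w z / ?k)\<^sup>2 * B z z + 2 * (- B w z / ?k) * B w z = - ((B w z)\<^sup>2 * (2 + B z z) / ?k\<^sup>2)"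
      using k by (simp add: divide_simps power2_eq_square) (simp add: algebra_simps)
    then have "(B w z)\<^sup>2 * (2 + B z z) / ?k\<^sup>2 \<le> 0"
      using *[of "- B w z / ?k"] by linarith
    then have "(B w z)\<^sup>2 * (2 + B z z) \<le> 0"
      using k by (simp add: divide_le_0_iff)
    moreover have "2 + B z z > 0" using k by simp
    ultimately have "(B w z)\<^sup>2 \<le> 0"
      by (simp add: mult_le_0_iff)
    then show ?thesis by simp
  qed
  moreover have "\<mu> *\<^sub>R w - f w \<in> W"
    using assms(2,4) wW by (simp add: subspace_diff subspace_scale)
  ultimately have "B w (\<mu> *\<^sub>R w - f w) = 0" by blast
  then have "inner (\<mu> *\<^sub>R w - f w) (\<mu> *\<^sub>R w - f w) = 0"
    by (simp add: B_def inner_diff_left)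
  then have "f w = \<mu> *\<^sub>R w" by simp
  then show thesis using that wW ww by force
qed

context euclidean_jordan_algebra
begin

section \<open>Bilinearity and linearisations of the Jordan identity\<close>

lemma jprod_add_left: "(x + y) \<odot> z = x \<odot> z + y \<odot> z"
  by (rule bilinear_ladd[OF bilinear_jprod])

lemma jprod_add_right: "z \<odot> (x + y) = z \<odot> x + z \<odot> y"
  by (rule bilinear_radd[OF bilinear_jprod])

lemma jprod_diff_left: "(x - y) \<odot> z = x \<odot> z - y \<odot> z"
  by (rule bilinear_lsub[OF bilinear_jprod])

lemma jprod_diff_right: "z \<odot> (x - y) = z \<odot> x - z \<odot> y"
  by (rule bilinear_rsub[OF bilinear_jprod])

lemma jprod_scaleR_left [simp]: "(k *\<^sub>R x) \<odot> z = k *\<^sub>R (x \<odot> z)"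
  by (rule bilinear_lmul[OF bilinear_jprod])

lemma jprod_scaleR_right [simp]: "z \<odot> (k *\<^sub>R x) = k *\<^sub>R (z \<odot> x)"
  by (rule bilinear_rmul[OF bilinear_jprod])

lemma jprod_zero_left [simp]: "0 \<odot> z = 0"
  by (rule bilinear_lzero[OF bilinear_jprod])

lemma jprod_zero_right [simp]: "z \<odot> 0 = 0"
  by (rule bilinear_rzero[OF bilinear_jprod])

lemma linear_jprod_right: "linear (\<lambda>y. x \<odot> y)"
  using bilinear_jprod by (auto simp: bilinear_def)

lemma linear_jprod_left: "linear (\<lambda>y. y \<odot> x)"
  using bilinear_jprod by (auto simp: bilinear_def)

lemma jprod_sum_right: "x \<odot> (\<Sum>i\<in>A. f i) = (\<Sum>i\<in>A. x \<odot> f i)"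
  by (rule linear_sum[OF linear_jprod_right])

lemma jprod_sum_left: "(\<Sum>i\<in>A. f i) \<odot> x = (\<Sum>i\<in>A. f i \<odot> x)"
  by (rule linear_sum[OF linear_jprod_left])

lemmas jprod_simps = jprod_add_left jprod_add_right jprod_diff_left jprod_diff_right

lemma unit_jprod_right [simp]: "x \<odot> e = x"
  using unit_jprod jprod_commute by metis

lemmas unit_jprod_left [simp] = unit_jprod

lemma inner_jprod_shift: "inner (x \<odot> y) z = inner x (y \<odot> z)"
  using inner_jprod jprod_commute by metis

text \<open>\<open>G\<close> is cubic in its argument, so the alternating sum over subsets of
  \<open>a, b, c\<close> is its full polarisation; by commutativity every term occurs in it
  twice.\<close>

lemma jordan_identity_linear:
  "(a \<odot> b) \<odot> (c \<odot> y) + (b \<odot> c) \<odot> (a \<odot> y) + (c \<odot> a) \<odot> (b \<odot> y)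
   = c \<odot> ((a \<odot> b) \<odot> y) + a \<odot> ((b \<odot> c) \<odot> y) + b \<odot> ((c \<odot> a) \<odot> y)"
proof -
  define G where "G x = (x \<odot> x) \<odot> (x \<odot> y) - x \<odot> ((x \<odot> x) \<odot> y)" for x
  have G0: "G x = 0" for x
    unfolding G_def using jordan_identity by simp
  have comm: "b \<odot> a = a \<odot> b" "c \<odot> b = b \<odot> c" "a \<odot> c = c \<odot> a"
    by (auto simp: jprod_commute)
  define R where "R = (a \<odot> b) \<odot> (c \<odot> y) + (b \<odot> c) \<odot> (a \<odot> y) + (c \<odot> a) \<odot> (b \<odot> y)
   - (c \<odot> ((a \<odot> b) \<odot> y) + a \<odot> ((b \<odot> c) \<odot> y) + b \<odot> ((c \<odot> a) \<odot> y))"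
  have "G (a + b + c) - G (a + b) - G (b + c) - G (a + c) + G a + G b + G c = R + R"
    unfolding G_def R_def by (simp add: jprod_simps comm algebra_simps)
  then have "R + R = 0" by (simp add: G0)
  then have "R = 0" by (metis scaleR_2 scaleR_eq_0_iff zero_neq_numeral)
  then show ?thesis unfolding R_def by simp
qed

text \<open>The left side of the linearised identity runs over the three pairings of
  \<open>a, b, c, y\<close> and is therefore symmetric in all four. Equating the right sides before
  and after exchanging \<open>b\<close> and \<open>y\<close> isolates multiplication by a triple
  product.\<close>

lemma jordan_operator_identity:
  "(b \<odot> (c \<odot> a)) \<odot> y
   = a \<odot> ((b \<odot> c) \<odot> y) + b \<odot> ((c \<odot> a) \<odot> y) + c \<odot> ((a \<odot> b) \<odot> y)
     - a \<odot> (b \<odot> (c \<odot> y)) - c \<odot> (b \<odot> (a \<odot> y))"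
proof -
  have "(a \<odot> b) \<odot> (c \<odot> y) + (b \<odot> c) \<odot> (a \<odot> y) + (c \<odot> a) \<odot> (b \<odot> y)
   = (a \<odot> y) \<odot> (c \<odot> b) + (y \<odot> c) \<odot> (a \<odot> b) + (c \<odot> a) \<odot> (y \<odot> b)"
    using jprod_commute by (simp add: jprod_commute add.commute add.left_commute)
  then have "c \<odot> ((a \<odot> b) \<odot> y) + a \<odot> ((b \<odot> c) \<odot> y) + b \<odot> ((c \<odot> a) \<odot> y)
    = c \<odot> ((a \<odot> y) \<odot> b) + a \<odot> ((y \<odot> c) \<odot> b) + y \<odot> ((c \<odot> a) \<odot> b)"
    using jordan_identity_linear[of a b c y] jordan_identity_linear[of a y c b] by simp
  moreover have "y \<odot> ((c \<odot> a) \<odot> b) = (b \<odot> (c \<odot> a)) \<odot> y"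
    "c \<odot> ((a \<odot> y) \<odot> b) = c \<odot> (b \<odot> (a \<odot> y))"
    "a \<odot> ((y \<odot> c) \<odot> b) = a \<odot> (b \<odot> (c \<odot> y))"
    by (metis jprod_commute)+
  ultimately show ?thesis by (simp add: algebra_simps)
qed

text \<open>The operator identity with all three factors equal to \<open>c\<close>. The polynomial
  \<open>2 t^3 - 3 t^2 + t\<close> has the roots 0, 1/2 and 1.\<close>

lemma idempotent_cubic:
  assumes "c \<odot> c = c"
  shows "c \<odot> y = 3 *\<^sub>R (c \<odot> (c \<odot> y)) - 2 *\<^sub>R (c \<odot> (c \<odot> (c \<odot> y)))"
proof -
  have "3 *\<^sub>R v = v + v + v" for v :: 'a
    using scaleR_left_distrib[of 1 2 v] by (simp add: scaleR_2)
  then show ?thesis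
    using jordan_operator_identity[of c c c y] assms by (simp add: scaleR_2 algebra_simps)
qed

text \<open>On the possible eigenvalues 0, 1/2, 1 of multiplication by an idempotent, \<open>t = t\<^sup>2 + 4 (t - t\<^sup>2)\<^sup>2\<close>.\<close>

lemma inner_idempotent_jprod:
  assumes "c \<odot> c = c"
  shows "inner (c \<odot> x) x = (norm (c \<odot> x))\<^sup>2 + 4 * (norm (c \<odot> x - c \<odot> (c \<odot> x)))\<^sup>2"
proof -
  let ?L = "\<lambda>y. c \<odot> y"
  have sym: "inner (?L u) v = inner u (?L v)" for u v by (rule inner_jprod)
  have 1: "inner (?L x) x = 3 * inner (?L (?L x)) x - 2 * inner (?L (?L (?L x))) x"
    by (subst idempotent_cubic[OF assms]) (simp add: inner_diff_left)
  have 2: "inner (?L (?L x)) (?L x) = inner (?L (?L (?L x))) x"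
    by (metis sym)
  have 3: "inner (?L (?L x)) (?L (?L x)) = inner (?L (?L (?L (?L x)))) x"
    by (metis sym)
  have 4: "inner (?L (?L x)) x = 3 * inner (?L (?L (?L x))) x - 2 * inner (?L (?L (?L (?L x)))) x"
    by (subst idempotent_cubic[OF assms]) (simp add: inner_diff_left)
  have 5: "inner (?L x) (?L x) = inner (?L (?L x)) x" by (metis sym)
  have 6: "(norm (?L x - ?L (?L x)))\<^sup>2 = inner (?L (?L x)) x - 2 * inner (?L (?L (?L x))) x + inner (?L (?L (?L (?L x)))) x"
    unfolding power2_norm_eq_inner using 2 3 5
    by (simp add: inner_diff_left inner_diff_right inner_commute)
  show ?thesis unfolding 6 unfolding power2_norm_eq_inner using 1 4 5 by (simp add: algebra_simps)
qed

lemma inner_idempotent_nonneg: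
  assumes "c \<odot> c = c"
  shows "0 \<le> inner (c \<odot> x) x"
  unfolding inner_idempotent_jprod[OF assms] by simp

lemma inner_idempotents:
  assumes "d \<odot> d = d"
  shows "inner c d = inner (c \<odot> d) d"
  using assms inner_jprod_shift by metis

lemma inner_idempotents_nonneg:
  assumes "c \<odot> c = c" "d \<odot> d = d"
  shows "0 \<le> inner c d"
  using inner_idempotent_nonneg[OF assms(1)] inner_idempotents[OF assms(2)] by metis

text \<open>\<open>inner c d\<close> is the quadratic form of multiplication by \<open>c\<close> at
  \<open>d\<close>, which is a sum of squares including that of the norm of
  \<open>c \<odot> d\<close>.\<close>

lemma idempotents_orthogonal:
  assumes "c \<odot> c = c" "d \<odot> d = d" "inner c d = 0"
  shows "c \<odot> d = 0"
proof -
  have "(norm (c \<odot> d))\<^sup>2 + 4 * (norm (c \<odot> d - c \<odot> (c \<odot> d)))\<^sup>2 = 0"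
    using inner_idempotent_jprod[OF assms(1)] inner_idempotents[OF assms(2)] assms(3) by metis
  then have "(norm (c \<odot> d))\<^sup>2 = 0"
    by (smt (verit) zero_le_power2)
  then show ?thesis by simp
qed

lemma inner_idempotent_unit:
  assumes "c \<odot> c = c"
  shows "inner c e = (norm c)\<^sup>2"
  using assms inner_jprod_shift[of c c e] by (simp add: power2_norm_eq_inner)

lemma idempotent_diff:
  assumes "c \<odot> c = c" "d \<odot> d = d" "c \<odot> d = d"
  shows "(c - d) \<odot> (c - d) = c - d"
  using assms jprod_commute[of d c] by (simp add: jprod_simps)

section \<open>Powers of an element and associativity of their span\<close>

definition jpower :: "'a \<Rightarrow> nat \<Rightarrow> 'a" where
  "jpower x n = ((\<lambda>y. x \<odot> y) ^^ n) e"

lemma jpower_0 [simp]: "jpower x 0 = e"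
  and jpower_Suc [simp]: "jpower x (Suc n) = x \<odot> jpower x n"
  by (simp_all add: jpower_def)

text \<open>The operator identity with factors \<open>x\<close>, \<open>x\<close> and
  \<open>jpower x m\<close> writes multiplication by the power \<open>m + 2\<close> in terms of
  multiplications by \<open>x\<close>, \<open>x \<odot> x\<close> and the powers \<open>m\<close>
  and \<open>m + 1\<close>, so commutation passes up by induction.\<close>

lemma jpower_commute_operator:
  assumes "linear T" "\<And>y. T (x \<odot> y) = x \<odot> T y" "\<And>y. T ((x \<odot> x) \<odot> y) = (x \<odot> x) \<odot> T y"
  shows "T (jpower x n \<odot> y) = jpower x n \<odot> T y"
proof (induction n arbitrary: y rule: less_induct)
  case (less n)
  consider "n = 0" | "n = 1" | m where "n = Suc (Suc m)"
    by (metis One_nat_def not0_implies_Suc)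
  then show ?case
  proof cases
    case 3
    have IH: "T (jpower x m \<odot> y) = jpower x m \<odot> T y"
      "T ((x \<odot> jpower x m) \<odot> y) = (x \<odot> jpower x m) \<odot> T y"
      "T ((jpower x m \<odot> x) \<odot> y) = (jpower x m \<odot> x) \<odot> T y" for y
      using less.IH[of m] less.IH[of "Suc m"] 3 jprod_commute by simp_all
    show ?thesis
      unfolding 3 jpower_Suc jordan_operator_identity[of x x "jpower x m"]
      by (simp add: linear_add[OF assms(1)] linear_diff[OF assms(1)] IH assms)
  qed (use assms in simp_all)
qed

text \<open>Two rounds of the preceding lemma: first with multiplication by \<open>x\<close> and by
  \<open>x \<odot> x\<close> as the operator, then with multiplication by a power.\<close>

lemma jpower_commute: "jpower x m \<odot> (jpower x n \<odot> y) = jpower x n \<odot> (jpower x m \<odot> y)"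
proof -
  have "x \<odot> (jpower x n \<odot> y) = jpower x n \<odot> (x \<odot> y)" for n y
    by (rule jpower_commute_operator) (simp_all add: linear_jprod_right jordan_identity)
  moreover have "(x \<odot> x) \<odot> (jpower x n \<odot> y) = jpower x n \<odot> ((x \<odot> x) \<odot> y)" for n y
    by (rule jpower_commute_operator) (simp_all add: linear_jprod_right jordan_identity)
  ultimately show ?thesis
    by (intro jpower_commute_operator linear_jprod_right) simp_all
qed

lemma jpower_add: "jpower x m \<odot> jpower x n = jpower x (m + n)"
proof (induction m)
  case (Suc m)
  have "jpower x (Suc m) \<odot> jpower x n = jpower x n \<odot> (jpower x 1 \<odot> jpower x m)"
    by (simp add: jprod_commute)
  also have "\<dots> = x \<odot> (jpower x m \<odot> jpower x n)"
    using jpower_commute[of x n 1 "jpower x m"] by (simp add: jprod_commute)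
  finally show ?case using Suc by simp
qed simp

lemma span_jpower_commute:
  assumes "u \<in> span (range (jpower x))" "v \<in> span (range (jpower x))"
  shows "u \<odot> (v \<odot> y) = v \<odot> (u \<odot> y)"
  using assms(2)
proof (induction rule: span_induct)
  case base
  show ?case by (auto simp: subspace_def jprod_simps)
next
  case (step v)
  then obtain n where v: "v = jpower x n" by blast
  from assms(1) show ?case
  proof (induction rule: span_induct)
    case base
    show ?case by (auto simp: subspace_def jprod_simps)
  next
    case (step u)
    then show ?case using v jpower_commute by blast
  qed
qed

lemma span_jpower_closed:
  assumes "u \<in> span (range (jpower x))" "v \<in> span (range (jpower x))"
  shows "u \<odot> v \<in> span (range (jpower x))"
  using assms(2)
proof (induction rule: span_induct)
  case base
  show ?case by (auto simp: subspace_def jprod_simps intro: span_zero span_add span_scale)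
next
  case (step v)
  then obtain n where v: "v = jpower x n" by blast
  from assms(1) show ?case
  proof (induction rule: span_induct)
    case base
    show ?case by (auto simp: subspace_def jprod_simps intro: span_zero span_add span_scale)
  next
    case (step u)
    then show ?case using v jpower_add by (auto intro: span_base)
  qed
qed

section \<open>Orthogonal families of idempotents and the spectral theorem\<close>

definition orthogonal_idempotents :: "'a set \<Rightarrow> bool" where
  "orthogonal_idempotents F \<longleftrightarrow> finite F \<and> (\<forall>c\<in>F. c \<odot> c = c \<and> c \<noteq> 0) \<and>
     (\<forall>c\<in>F. \<forall>d\<in>F. c \<noteq> d \<longrightarrow> c \<odot> d = 0)"

text \<open>Induction on the dimension. Multiplication by some \<open>y\<close> that is not a
  multiple of the unit has an eigenvector in \<open>W\<close>. Its eigenspace \<open>E1\<close> and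
  the orthogonal complement \<open>E2\<close> in \<open>W\<close> are proper ideals that annihilate
  each other, and the components of \<open>i\<close> are their units; the two families obtained for
  them are united.\<close>

lemma associative_subalgebra_span:
  assumes "subspace W" "\<And>u v. u \<in> W \<Longrightarrow> v \<in> W \<Longrightarrow> u \<odot> v \<in> W"
    and "\<And>u v w. u \<in> W \<Longrightarrow> v \<in> W \<Longrightarrow> w \<in> W \<Longrightarrow> u \<odot> (v \<odot> w) = v \<odot> (u \<odot> w)"
    and "i \<in> W" "\<And>w. w \<in> W \<Longrightarrow> i \<odot> w = w"
  shows "\<exists>F. orthogonal_idempotents F \<and> F \<subseteq> W \<and> W \<subseteq> span F \<and> \<Sum>F = i"
  using assms
proof (induction "dim W" arbitrary: W i rule: less_induct)
  case less
  note subW = less.prems(1) and closed = less.prems(2) and comm = less.prems(3)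
    and iW = less.prems(4) and unit = less.prems(5)
  show ?case
  proof (cases "W \<subseteq> span {i}")
    case True
    show ?thesis
    proof (cases "i = 0")
      case True
      then show ?thesis using \<open>W \<subseteq> span {i}\<close>
        by (intro exI[of _ "{}"]) (auto simp: orthogonal_idempotents_def span_insert_0)
    next
      case False
      then show ?thesis using True iW unit[OF iW]
        by (intro exI[of _ "{i}"]) (auto simp: orthogonal_idempotents_def)
    qed
  next
    case False
    then obtain y where y: "y \<in> W" "y \<notin> span {i}" by blast
    have "W \<noteq> {0}" using y span_zero by blast
    then obtain w \<mu> where w: "w \<in> W" "w \<noteq> 0" "y \<odot> w = \<mu> *\<^sub>R w"
      using symmetric_eigenvector[OF linear_jprod_right subW, of y] closed y(1) inner_jprod by metis
    define E1 where "E1 = {v \<in> W. y \<odot> v = \<mu> *\<^sub>R v}"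
    define E2 where "E2 = {v \<in> W. \<forall>u\<in>E1. inner v u = 0}"
    have sub1: "subspace E1" and sub2: "subspace E2"
      using subW unfolding E1_def E2_def subspace_def
      by (auto simp: jprod_simps algebra_simps inner_add_left)
    have E1W: "E1 \<subseteq> W" and E2W: "E2 \<subseteq> W" by (auto simp: E1_def E2_def)
    have ideal1: "u \<odot> v \<in> E1" if "u \<in> W" "v \<in> E1" for u v
      using that comm[of y u v] y(1) closed by (auto simp: E1_def)
    have ideal2: "u \<odot> v \<in> E2" if "u \<in> W" "v \<in> E2" for u v
    proof -
      have "inner (u \<odot> v) z = 0" if "z \<in> E1" for z
      proof -
        have "inner (u \<odot> v) z = inner v (u \<odot> z)" by (rule inner_jprod)
        then show ?thesis using \<open>v \<in> E2\<close> ideal1[OF \<open>u \<in> W\<close> that] by (auto simp: E2_def)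
      qed
      then show ?thesis using that closed by (auto simp: E2_def)
    qed
    have disj: "v = 0" if "v \<in> E1" "v \<in> E2" for v
      using that by (auto simp: E2_def)
    have cross: "u \<odot> v = 0" if "u \<in> E1" "v \<in> E2" for u v
    proof (rule disj)
      show "u \<odot> v \<in> E2" using that ideal2 E1W by blast
      show "u \<odot> v \<in> E1" using that ideal1[of v u] E2W jprod_commute by (metis subsetD)
    qed
    have decomp: "\<exists>v1\<in>E1. \<exists>v2\<in>E2. v = v1 + v2" if "v \<in> W" for v
    proof -
      obtain v1 v2 where v: "v1 \<in> span E1" "\<And>z. z \<in> span E1 \<Longrightarrow> orthogonal v2 z" "v = v1 + v2"
        using orthogonal_subspace_decomp_exists[of E1 v] by blast
      have v1: "v1 \<in> E1" using v(1) sub1 by (simp add: span_eq_iff[THEN iffD2])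
      moreover have "v2 = v - v1" using v(3) by simp
      then have "v2 \<in> W" using subspace_diff[OF subW that, of v1] v1 E1W by auto
      then have "v2 \<in> E2" using v(2) span_base by (auto simp: E2_def orthogonal_def)
      ultimately show ?thesis using v(3) by blast
    qed
    have "i \<notin> E1"
    proof
      assume "i \<in> E1"
      then have "y = \<mu> *\<^sub>R i" using unit[OF y(1)] by (auto simp: E1_def jprod_commute)
      then show False using y(2) span_base span_scale by blast
    qed
    then have "E1 \<subset> W" using iW E1W by blast
    then have dim1: "dim E1 < dim W"
      by (metis dim_psubset span_eq_iff sub1 subW)
    have "w \<in> E1" using w by (simp add: E1_def)
    then have "w \<notin> E2" using disj w by blast
    then have "E2 \<subset> W" using w E2W by blast
    then have dim2: "dim E2 < dim W"
      by (metis dim_psubset span_eq_iff sub2 subW)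
    obtain i1 i2 where i: "i1 \<in> E1" "i2 \<in> E2" "i = i1 + i2" using decomp[OF iW] by blast
    have unit1: "i1 \<odot> v = v" if "v \<in> E1" for v
      using unit[of v] that E1W i cross[OF that i(2)] jprod_commute[of v i2] by (auto simp: jprod_simps)
    have unit2: "i2 \<odot> v = v" if "v \<in> E2" for v
      using unit[of v] that E2W i cross[OF i(1) that] by (auto simp: jprod_simps)
    have closed1: "u \<odot> v \<in> E1" if "u \<in> E1" "v \<in> E1" for u v
      using ideal1 that E1W by blast
    have comm1: "u \<odot> (v \<odot> w) = v \<odot> (u \<odot> w)" if "u \<in> E1" "v \<in> E1" "w \<in> E1" for u v w
      using comm that E1W by blast
    obtain F1 where F1: "orthogonal_idempotents F1" "F1 \<subseteq> E1" "E1 \<subseteq> span F1" "\<Sum>F1 = i1"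
      using less.hyps[OF dim1 sub1 closed1 comm1 i(1) unit1] by blast
    have closed2: "u \<odot> v \<in> E2" if "u \<in> E2" "v \<in> E2" for u v
      using ideal2 that E2W by blast
    have comm2: "u \<odot> (v \<odot> w) = v \<odot> (u \<odot> w)" if "u \<in> E2" "v \<in> E2" "w \<in> E2" for u v w
      using comm that E2W by blast
    obtain F2 where F2: "orthogonal_idempotents F2" "F2 \<subseteq> E2" "E2 \<subseteq> span F2" "\<Sum>F2 = i2"
      using less.hyps[OF dim2 sub2 closed2 comm2 i(2) unit2] by blast
    have c12: "c \<odot> d = 0" "d \<odot> c = 0" if "c \<in> F1" "d \<in> F2" for c d
      using cross[of c d] that F1(2) F2(2) jprod_commute[of c d] by (simp_all add: subset_iff)
    have "F1 \<inter> F2 = {}"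
    proof (rule ccontr)
      assume "F1 \<inter> F2 \<noteq> {}"
      then obtain c where c: "c \<in> F1" "c \<in> F2" by blast
      then have "c = 0" using disj F1(2) F2(2) by (simp add: subset_iff)
      then show False using F1(1) c by (auto simp: orthogonal_idempotents_def)
    qed
    then have "\<Sum>(F1 \<union> F2) = i"
      using F1 F2 i by (simp add: sum.union_disjoint orthogonal_idempotents_def)
    moreover have "W \<subseteq> span (F1 \<union> F2)"
    proof
      fix v assume "v \<in> W"
      then obtain v1 v2 where "v1 \<in> E1" "v2 \<in> E2" "v = v1 + v2" using decomp by blast
      then show "v \<in> span (F1 \<union> F2)"
        using F1(3) F2(3) span_mono[of F1 "F1 \<union> F2"] span_mono[of F2 "F1 \<union> F2"]
        by (simp add: span_add subset_iff)
    qed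
    moreover have "orthogonal_idempotents (F1 \<union> F2)"
      using F1(1) F2(1) c12 unfolding orthogonal_idempotents_def by (auto simp: c12)
    ultimately show ?thesis
      using F1(2) F2(2) E1W E2W by (intro exI[of _ "F1 \<union> F2"]) blast
  qed
qed

lemma orthogonal_idempotents_card:
  assumes "orthogonal_idempotents F"
  shows "card F \<le> DIM('a)"
proof -
  have "inner c d = 0" if "c \<in> F" "d \<in> F" "c \<noteq> d" for c d
    using assms that inner_idempotents[of d c] by (auto simp: orthogonal_idempotents_def)
  then have "pairwise orthogonal F" by (auto simp: pairwise_def orthogonal_def)
  moreover have "0 \<notin> F" using assms by (auto simp: orthogonal_idempotents_def)
  ultimately have "independent F" by (rule pairwise_orthogonal_independent)
  then show ?thesis using independent_bound by blast
qed

text \<open>Squaring \<open>c1 + c2\<close> gives \<open>c1 \<odot> c2 = 0\<close>. For another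
  member \<open>d\<close>, the nonnegative numbers \<open>inner c1 d\<close> and
  \<open>inner c2 d\<close> add up to \<open>inner c d = 0\<close>, so both parts are orthogonal to
  \<open>d\<close>.\<close>

lemma orthogonal_idempotents_refine:
  assumes F: "orthogonal_idempotents F" and c: "c \<in> F"
    and c1: "c1 \<odot> c1 = c1" "c1 \<noteq> 0" and c2: "c2 \<odot> c2 = c2" "c2 \<noteq> 0" and cc: "c = c1 + c2"
  defines "F' \<equiv> insert c1 (insert c2 (F - {c}))"
  shows "orthogonal_idempotents F'" "card F' = Suc (card F)" "\<Sum>F' = \<Sum>F" "span F \<subseteq> span F'"
proof -
  have fin: "finite F" and idem: "\<And>d. d \<in> F \<Longrightarrow> d \<odot> d = d" and nz: "\<And>d. d \<in> F \<Longrightarrow> d \<noteq> 0"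
    and orth: "\<And>d d'. d \<in> F \<Longrightarrow> d' \<in> F \<Longrightarrow> d \<noteq> d' \<Longrightarrow> d \<odot> d' = 0"
    using F by (auto simp: orthogonal_idempotents_def)
  have "c1 \<odot> c2 + c1 \<odot> c2 = 0"
    using idem[OF c] c1(1) c2(1) jprod_commute[of c2 c1] unfolding cc by (simp add: jprod_simps algebra_simps)
  then have c12: "c1 \<odot> c2 = 0" by (metis scaleR_2 scaleR_eq_0_iff zero_neq_numeral)
  then have c21: "c2 \<odot> c1 = 0" using jprod_commute by metis
  have sub: "c1 \<odot> d = 0 \<and> d \<odot> c1 = 0 \<and> c2 \<odot> d = 0 \<and> d \<odot> c2 = 0" if "d \<in> F - {c}" for d
  proof -
    have "inner c d = 0"
      using inner_idempotents[of d c] orth[of c d] idem that c by auto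
    then have "inner c1 d + inner c2 d = 0" by (simp add: cc inner_add_left)
    then have "inner c1 d = 0" "inner c2 d = 0"
      using inner_idempotents_nonneg[of c1 d] inner_idempotents_nonneg[of c2 d] c1 c2 idem[of d] that
      by auto
    then have "c1 \<odot> d = 0" "c2 \<odot> d = 0"
      using idempotents_orthogonal c1 c2 idem[of d] that by auto
    then show ?thesis using jprod_commute by metis
  qed
  have ne: "c1 \<noteq> c2" using c12 c1 by auto
  have notin: "c1 \<notin> F - {c}" "c2 \<notin> F - {c}" using sub[of c1] sub[of c2] c1 c2 by auto
  show "orthogonal_idempotents F'"
    using fin idem nz orth sub c1 c2 c12 c21 unfolding F'_def orthogonal_idempotents_def by auto
  show "card F' = Suc (card F)"
    using fin ne notin c card_Suc_Diff1[OF fin c] unfolding F'_def by simp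
  show "\<Sum>F' = \<Sum>F"
    using fin ne notin sum.remove[OF fin c, of id] unfolding F'_def by (simp add: cc add.assoc)
  have "c \<in> span F'" unfolding cc F'_def by (intro span_add span_base) auto
  moreover have "d \<in> span F'" if "d \<in> F - {c}" for d using that unfolding F'_def by (auto intro: span_base)
  ultimately have "F \<subseteq> span F'" by blast
  then show "span F \<subseteq> span F'" by (simp add: span_minimal)
qed

text \<open>Cardinalities are bounded by the dimension, so a largest admissible family exists;
  splitting a member that is not primitive would enlarge it. The members of \<open>K\<close> are
  primitive and hence never split.\<close>

lemma orthogonal_idempotents_extend_frame:
  assumes F: "orthogonal_idempotents F" "\<Sum>F = e" "x \<in> span F"
    and K: "K \<subseteq> F" "\<And>c. c \<in> K \<Longrightarrow> primitive_idempotent (\<odot>) c"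
  shows "\<exists>G. jordan_frame (\<odot>) e G \<and> x \<in> span G \<and> K \<subseteq> G"
proof -
  let ?P = "\<lambda>G. orthogonal_idempotents G \<and> \<Sum>G = e \<and> x \<in> span G \<and> K \<subseteq> G"
  have "\<exists>G. ?P G \<and> (\<forall>G'. ?P G' \<longrightarrow> card G' \<le> card G)"
  proof (rule Lattices_Big.ex_has_greatest_nat)
    show "?P F" using F K by blast
    show "\<forall>G. ?P G \<longrightarrow> card G < Suc DIM('a)"
      using orthogonal_idempotents_card by (simp add: less_Suc_eq_le)
  qed
  then obtain G where G: "?P G" and max: "\<And>G'. ?P G' \<Longrightarrow> card G' \<le> card G" by blast
  have "primitive_idempotent (\<odot>) c" if c: "c \<in> G" for c
  proof (rule ccontr)
    assume np: "\<not> primitive_idempotent (\<odot>) c"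
    then obtain c1 c2 where cc: "c1 \<odot> c1 = c1" "c1 \<noteq> 0" "c2 \<odot> c2 = c2" "c2 \<noteq> 0" "c = c1 + c2"
      using G c unfolding primitive_idempotent_def jordan_idempotent_def orthogonal_idempotents_def by blast
    note R = orthogonal_idempotents_refine[OF conjunct1[OF G] c cc]
    have "K \<subseteq> insert c1 (insert c2 (G - {c}))" using G K(2) np by blast
    then have "?P (insert c1 (insert c2 (G - {c})))" using R G by auto
    from max[OF this] R(2) show False by simp
  qed
  then have "jordan_frame (\<odot>) e G"
    using G by (auto simp: jordan_frame_def orthogonal_idempotents_def)
  then show ?thesis using G by blast
qed

text \<open>The span of the powers of \<open>x\<close> is an associative subalgebra containing
  \<open>e\<close> and \<open>x\<close>; the idempotents spanning it are refined to a frame.\<close>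

lemma spectral_theorem:
  obtains F \<phi> where "jordan_frame (\<odot>) e F" "x = (\<Sum>c\<in>F. \<phi> c *\<^sub>R c)"
proof -
  let ?W = "span (range (jpower x))"
  have eW: "e \<in> ?W" and xW: "x \<in> ?W"
    using span_base[OF rangeI[of "jpower x" 0]] span_base[OF rangeI[of "jpower x" 1]] by simp_all
  obtain F where F: "orthogonal_idempotents F" "?W \<subseteq> span F" "\<Sum>F = e"
    using associative_subalgebra_span[of ?W e] span_jpower_commute span_jpower_closed eW by force
  then obtain G where G: "jordan_frame (\<odot>) e G" "x \<in> span G"
    using orthogonal_idempotents_extend_frame[of F x "{}"] xW by blast
  then have "x \<in> range (\<lambda>u. \<Sum>v\<in>G. u v *\<^sub>R v)"
    using span_finite[of G] by (auto simp: jordan_frame_def)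
  then show thesis using that G by blast
qed

lemma primitive_in_frame:
  assumes "primitive_idempotent (\<odot>) c"
  obtains F where "jordan_frame (\<odot>) e F" "c \<in> F"
proof -
  have c: "c \<odot> c = c" "c \<noteq> 0" using assms by (auto simp: primitive_idempotent_def jordan_idempotent_def)
  \<comment> \<open>For \<open>c = e\<close> the complement \<open>e - c\<close> would be zero and
    is left out.\<close>
  define F where "F = (if c = e then {e} else {c, e - c})"
  have "orthogonal_idempotents F" "\<Sum>F = e"
  proof -
    have "c \<noteq> e - c"
    proof
      assume "c = e - c"
      then have "c \<odot> c = c \<odot> (e - c)" by simp
      then show False using c by (simp add: jprod_diff_right)
    qed
    then show "\<Sum>F = e" by (simp add: F_def)
    show "orthogonal_idempotents F"
      using c unfolding orthogonal_idempotents_def F_def by (auto simp: jprod_simps)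
  qed
  moreover have "c \<in> F" by (simp add: F_def)
  ultimately show thesis
    using orthogonal_idempotents_extend_frame[of F 0 "{c}"] assms that span_zero by blast
qed

section \<open>Peirce decomposition and positivity of the quadratic representation\<close>

lemma frameD:
  assumes "jordan_frame (\<odot>) e F"
  shows "finite F" "c \<in> F \<Longrightarrow> primitive_idempotent (\<odot>) c" "c \<in> F \<Longrightarrow> c \<odot> c = c" "c \<in> F \<Longrightarrow> c \<noteq> 0"
    "c \<in> F \<Longrightarrow> d \<in> F \<Longrightarrow> c \<noteq> d \<Longrightarrow> c \<odot> d = 0" "\<Sum>F = e"
  using assms by (auto simp: jordan_frame_def primitive_idempotent_def jordan_idempotent_def)

lemma primitiveD:
  assumes "primitive_idempotent (\<odot>) c"
  shows "c \<odot> c = c" "c \<noteq> 0"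
  using assms by (auto simp: primitive_idempotent_def jordan_idempotent_def)

lemma frame_jprod_sum:
  assumes F: "jordan_frame (\<odot>) e F" and c: "c \<in> F"
  shows "c \<odot> (\<Sum>d\<in>F. \<phi> d *\<^sub>R d) = \<phi> c *\<^sub>R c"
proof -
  have "c \<odot> (\<Sum>d\<in>F. \<phi> d *\<^sub>R d) = (\<Sum>d\<in>F. if d = c then \<phi> c *\<^sub>R c else 0)"
    unfolding jprod_sum_right using frameD[OF F] c by (intro sum.cong) auto
  then show ?thesis using frameD(1)[OF F] c by simp
qed

lemma frame_sum_jprod_sum:
  assumes F: "jordan_frame (\<odot>) e F"
  shows "(\<Sum>d\<in>F. \<phi> d *\<^sub>R d) \<odot> (\<Sum>d\<in>F. \<psi> d *\<^sub>R d) = (\<Sum>d\<in>F. (\<phi> d * \<psi> d) *\<^sub>R d)"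
  by (simp add: jprod_sum_left frame_jprod_sum[OF F])

text \<open>Otherwise \<open>d\<close> and \<open>c - d\<close> would split \<open>c\<close> into
  two nonzero idempotents.\<close>

lemma primitive_dominates:
  assumes "primitive_idempotent (\<odot>) c" "d \<odot> d = d" "d \<noteq> 0" "c \<odot> d = d"
  shows "d = c"
proof (rule ccontr)
  assume "d \<noteq> c"
  then have "jordan_idempotent (\<odot>) (c - d)" "c - d \<noteq> 0" "c = d + (c - d)"
    using idempotent_diff primitiveD[OF assms(1)] assms by (auto simp: jordan_idempotent_def)
  then show False
    using assms(1-3) unfolding primitive_idempotent_def jordan_idempotent_def by blast
qed

text \<open>The complement \<open>g = e - f\<close> annihilates \<open>x\<close>, so
  \<open>inner g (x \<odot> x) = 0\<close>. Over a frame diagonalising \<open>x\<close> this is a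
  sum of nonnegative terms, so a member with nonzero coefficient is orthogonal to \<open>g\<close>,
  hence dominated by \<open>f\<close> and equal to it.\<close>

lemma primitive_peirce_one:
  assumes f: "primitive_idempotent (\<odot>) f" and x: "f \<odot> x = x"
  obtains \<alpha> where "x = \<alpha> *\<^sub>R f"
proof -
  obtain F \<phi> where F: "jordan_frame (\<odot>) e F" and xF: "x = (\<Sum>c\<in>F. \<phi> c *\<^sub>R c)"
    using spectral_theorem by blast
  note FD = frameD[OF F]
  have ff: "f \<odot> f = f" using primitiveD[OF f] by simp
  define g where "g = e - f"
  have gg: "g \<odot> g = g" and gx: "g \<odot> x = 0"
    using x ff by (simp_all add: g_def jprod_simps)
  have "inner g (x \<odot> x) = 0"
    using inner_jprod[of x g x] gx jprod_commute[of g x] by simp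
  moreover have "inner g (x \<odot> x) = (\<Sum>c\<in>F. (\<phi> c)\<^sup>2 * inner g c)"
    unfolding xF frame_sum_jprod_sum[OF F] by (simp add: inner_sum_right power2_eq_square)
  moreover have "0 \<le> (\<phi> c)\<^sup>2 * inner g c" if "c \<in> F" for c
    using inner_idempotents_nonneg[OF gg FD(3)[OF that]] by simp
  ultimately have *: "(\<phi> c)\<^sup>2 * inner g c = 0" if "c \<in> F" for c
    using sum_nonneg_eq_0_iff[OF FD(1), of "\<lambda>c. (\<phi> c)\<^sup>2 * inner g c"] that by metis
  have **: "\<phi> c *\<^sub>R c = \<phi> c *\<^sub>R (if c = f then f else 0)" if c: "c \<in> F" for c
  proof (cases "\<phi> c = 0")
    case False
    then have "g \<odot> c = 0" using *[OF c] idempotents_orthogonal[OF gg FD(3)[OF c]] by simp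
    then have "f \<odot> c = c" by (simp add: g_def jprod_simps)
    then show ?thesis using primitive_dominates[OF f] FD c by auto
  qed simp
  have "x = (\<Sum>c\<in>F. \<phi> c *\<^sub>R (if c = f then f else 0))"
    unfolding xF using ** by (rule sum.cong[OF refl])
  also have "\<dots> = (\<Sum>c\<in>F. if c = f then \<phi> c else 0) *\<^sub>R f"
    unfolding scaleR_sum_left by (intro sum.cong) auto
  finally show thesis using that by blast
qed

lemma peirce_decomposition:
  assumes f: "f \<odot> f = f"
  obtains a1 h a0 where "a = a1 + h + a0" "f \<odot> a1 = a1" "f \<odot> h = (1/2) *\<^sub>R h" "f \<odot> a0 = 0"
proof -
  define u v w where "u = f \<odot> a" and "v = f \<odot> u" and "w = f \<odot> v"
  have cub: "w = (3/2) *\<^sub>R v - (1/2) *\<^sub>R u"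
  proof -
    have "u = 3 *\<^sub>R v - 2 *\<^sub>R w" using idempotent_cubic[OF f] by (simp add: u_def v_def w_def)
    then have "(1/2) *\<^sub>R u = (1/2) *\<^sub>R (3 *\<^sub>R v - 2 *\<^sub>R w)" by simp
    then show ?thesis by (simp add: algebra_simps)
  qed
  have fu: "f \<odot> u = v" and fv: "f \<odot> v = w" and fa: "f \<odot> a = u" by (simp_all add: u_def v_def w_def)
  show thesis
  proof
    \<comment> \<open>The three summands are the Lagrange polynomials \<open>2 t^2 - t\<close>,
      \<open>4 t - 4 t^2\<close> and \<open>1 - 3 t + 2 t^2\<close> for the eigenvalues 1, 1/2 and
      0, evaluated at multiplication by \<open>f\<close> and applied to \<open>a\<close>.\<close>
    show "a = (2 *\<^sub>R v - u) + (4 *\<^sub>R u - 4 *\<^sub>R v) + (a - 3 *\<^sub>R u + 2 *\<^sub>R v)"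
      by (rule vector_eq_ldot[THEN iffD1]) (simp add: inner_simps)
    show "f \<odot> (2 *\<^sub>R v - u) = 2 *\<^sub>R v - u"
      "f \<odot> (4 *\<^sub>R u - 4 *\<^sub>R v) = (1/2) *\<^sub>R (4 *\<^sub>R u - 4 *\<^sub>R v)"
      "f \<odot> (a - 3 *\<^sub>R u + 2 *\<^sub>R v) = 0"
      by (rule vector_eq_ldot[THEN iffD1], simp add: jprod_simps fu fv fa cub inner_simps)+
  qed
qed

lemma idempotent_commute:
  assumes f: "f \<odot> f = f" and c: "f \<odot> c = 0"
  shows "f \<odot> (c \<odot> y) = c \<odot> (f \<odot> y)"
  using jordan_identity_linear[of f f c y] f c jprod_commute[of c f] by simp

text \<open>In the linearised identity for \<open>h, h, f\<close> the mixed terms cancel because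
  \<open>h \<odot> f\<close> is half of \<open>h\<close>. As a consequence,
  \<open>h \<odot> h\<close> has no component in the half space of \<open>f\<close>.\<close>

lemma peirce_half_square:
  assumes f: "f \<odot> f = f" and h: "f \<odot> h = (1/2) *\<^sub>R h"
  shows "f \<odot> ((h \<odot> h) \<odot> y) = (h \<odot> h) \<odot> (f \<odot> y)"
proof -
  have "h \<odot> f = (1/2) *\<^sub>R h" using h jprod_commute by metis
  then show ?thesis
    using jordan_identity_linear[of h h f y] h by (simp add: algebra_simps)
qed

text \<open>Modelled on the symmetric matrices, where \<open>P\<^sub>a f = (a v) (a v)\<^sup>T\<close> has rank one for \<open>f = v v\<^sup>T\<close>.\<close>

lemma quadratic_rep_primitive:
  fixes a
  assumes f: "primitive_idempotent (\<odot>) f"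
  defines "X \<equiv> quadratic_rep (\<odot>) a f"
  obtains \<tau> where "0 \<le> \<tau>" "X \<odot> X = \<tau> *\<^sub>R X"
proof -
  note ff = primitiveD(1)[OF f]
  obtain b1 h a0 where a: "a = b1 + h + a0" and b1: "f \<odot> b1 = b1" and h: "f \<odot> h = (1/2) *\<^sub>R h"
    and a0: "f \<odot> a0 = 0"
    using peirce_decomposition[OF ff] by blast
  obtain \<beta> where b1f: "b1 = \<beta> *\<^sub>R f" using primitive_peirce_one[OF f b1] by blast
  have hf: "h \<odot> f = (1/2) *\<^sub>R h" and a0f: "a0 \<odot> f = 0" using h a0 jprod_commute by metis+
  \<comment> \<open>The component of \<open>h \<odot> h\<close> in the 1-space of \<open>f\<close>,
    a multiple of \<open>f\<close> by primitivity; the rest \<open>z\<close> lies in the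
    0-space.\<close>
  define w where "w = f \<odot> (h \<odot> h)"
  have fw: "f \<odot> w = w"
    using peirce_half_square[OF ff h, of f] ff jprod_commute[of f "h \<odot> h"] by (simp add: w_def)
  obtain \<alpha> where w: "w = \<alpha> *\<^sub>R f" using primitive_peirce_one[OF f fw] by blast
  define z where "z = h \<odot> h - w"
  have hh: "h \<odot> h = \<alpha> *\<^sub>R f + z" by (simp add: z_def w)
  have fz: "f \<odot> z = 0" using fw by (simp add: z_def jprod_simps w_def[symmetric])
  have zf: "z \<odot> f = 0" using fz jprod_commute by metis
  \<comment> \<open>The Jordan identity for \<open>h\<close> applied to \<open>f\<close>; comparing
    both sides determines \<open>z \<odot> h\<close>.\<close>
  have "h \<odot> ((h \<odot> h) \<odot> f) = (h \<odot> h) \<odot> (h \<odot> f)" by (rule jordan_identity)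
  then have "(\<alpha>/2) *\<^sub>R h = (1/2) *\<^sub>R ((\<alpha>/2) *\<^sub>R h + z \<odot> h)"
    by (simp add: hh hf h ff zf jprod_simps)
  then have "2 *\<^sub>R ((\<alpha>/2) *\<^sub>R h) = 2 *\<^sub>R ((1/2) *\<^sub>R ((\<alpha>/2) *\<^sub>R h + z \<odot> h))" by simp
  then have "\<alpha> *\<^sub>R h - (\<alpha>/2) *\<^sub>R h = z \<odot> h" by simp
  then have zh: "z \<odot> h = (\<alpha>/2) *\<^sub>R h" by (simp add: scaleR_left_diff_distrib[symmetric])
  then have hz: "h \<odot> z = (\<alpha>/2) *\<^sub>R h" using jprod_commute by metis
  have hhh: "h \<odot> (h \<odot> h) = \<alpha> *\<^sub>R h"
    by (simp add: hh hf hz jprod_simps scaleR_left_distrib[symmetric])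
  \<comment> \<open>Two expressions for the fourth power of \<open>h\<close>; their comparison gives
    \<open>z \<odot> z = \<alpha> *\<^sub>R z\<close>.\<close>
  have "(h \<odot> h) \<odot> (h \<odot> h) = h \<odot> (h \<odot> (h \<odot> h))"
    using jordan_identity[of h h] jprod_commute by metis
  then have "\<alpha>\<^sup>2 *\<^sub>R f + z \<odot> z = \<alpha>\<^sup>2 *\<^sub>R f + \<alpha> *\<^sub>R z"
    unfolding hhh by (simp add: hh ff fz zf jprod_simps power2_eq_square algebra_simps)
  then have zz: "z \<odot> z = \<alpha> *\<^sub>R z" by simp
  have fa00: "f \<odot> (a0 \<odot> a0) = 0" using idempotent_commute[OF ff a0, of a0] a0 by simp
  have fa0h: "f \<odot> (a0 \<odot> h) = (1/2) *\<^sub>R (a0 \<odot> h)" using idempotent_commute[OF ff a0, of h] h by simp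
  have comm: "h \<odot> a0 = a0 \<odot> h" "f \<odot> h = h \<odot> f" by (rule jprod_commute)+
  have af: "a \<odot> f = \<beta> *\<^sub>R f + (1/2) *\<^sub>R h"
    unfolding a b1f by (simp add: jprod_simps ff hf a0f)
  have ah: "a \<odot> h = (\<beta>/2) *\<^sub>R h + (\<alpha> *\<^sub>R f + z) + a0 \<odot> h"
    unfolding a b1f by (simp add: jprod_simps h hh)
  have "a \<odot> a = \<beta>\<^sup>2 *\<^sub>R f + \<beta> *\<^sub>R h + h \<odot> h + 2 *\<^sub>R (a0 \<odot> h) + a0 \<odot> a0"
    unfolding a b1f by (simp add: jprod_simps ff comm hf a0 a0f power2_eq_square scaleR_2 algebra_simps
      scaleR_left_distrib[of "1/2" "1/2", simplified, symmetric] flip: scaleR_left_distrib)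
  then have "f \<odot> (a \<odot> a) = \<beta>\<^sup>2 *\<^sub>R f + (\<beta>/2) *\<^sub>R h + \<alpha> *\<^sub>R f + a0 \<odot> h"
    by (simp add: jprod_simps ff h fa0h fa00 w_def[symmetric] w)
  then have aaf: "(a \<odot> a) \<odot> f = \<beta>\<^sup>2 *\<^sub>R f + (\<beta>/2) *\<^sub>R h + \<alpha> *\<^sub>R f + a0 \<odot> h"
    using jprod_commute by metis
  have X: "X = \<beta>\<^sup>2 *\<^sub>R f + \<beta> *\<^sub>R h + z"
    unfolding X_def quadratic_rep_def aaf
    by (rule vector_eq_ldot[THEN iffD1])
      (simp add: jprod_simps af ah inner_simps power2_eq_square field_simps)
  have "X \<odot> X = (\<beta>\<^sup>2 + \<alpha>) *\<^sub>R X"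
    unfolding X
    by (rule vector_eq_ldot[THEN iffD1])
      (simp add: jprod_simps ff h hf hh fz zf hz zh zz inner_simps power2_eq_square field_simps)
  moreover have "0 \<le> \<alpha>"
  proof -
    have "\<alpha> * inner f f = inner w f" by (simp add: w)
    also have "\<dots> = inner (h \<odot> f) h" using fw by (metis inner_jprod w_def ff inner_commute jprod_commute)
    also have "\<dots> = inner h h / 2" by (simp add: hf)
    finally have "\<alpha> * inner f f \<ge> 0" by (metis inner_ge_zero divide_nonneg_pos zero_less_numeral)
    moreover have "inner f f > 0" using primitiveD[OF f] by simp
    ultimately show ?thesis by (simp add: zero_le_mult_iff)
  qed
  ultimately show thesis using that[of "\<beta>\<^sup>2 + \<alpha>"] by simp
qed

text \<open>\<open>?X\<close> is zero if \<open>\<tau> = 0\<close>, since then its square vanishes,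
  and otherwise a positive multiple of an idempotent; idempotents have nonnegative inner
  products.\<close>

lemma quadratic_rep_nonneg:
  assumes f: "primitive_idempotent (\<odot>) f" and g: "g \<odot> g = g"
  shows "0 \<le> inner (quadratic_rep (\<odot>) a f) g"
proof -
  let ?X = "quadratic_rep (\<odot>) a f"
  obtain \<tau> where \<tau>: "0 \<le> \<tau>" "?X \<odot> ?X = \<tau> *\<^sub>R ?X" using quadratic_rep_primitive[OF f] by blast
  show ?thesis
  proof (cases "\<tau> = 0")
    case True
    then have "inner ?X ?X = 0" using \<tau> inner_jprod[of ?X ?X e] by simp
    then show ?thesis by simp
  next
    case False
    define d where "d = (1/\<tau>) *\<^sub>R ?X"
    have "d \<odot> d = d" using \<tau> False by (simp add: d_def)
    then have "0 \<le> inner d g" using inner_idempotents_nonneg g by blast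
    then show ?thesis using \<tau> False by (simp add: d_def zero_le_divide_iff)
  qed
qed

text \<open>This is the Jordan triple product with \<open>x\<close> as its middle factor.\<close>

definition polar_rep :: "'a \<Rightarrow> 'a \<Rightarrow> 'a \<Rightarrow> 'a" where
  "polar_rep a b x = a \<odot> (b \<odot> x) + b \<odot> (a \<odot> x) - (a \<odot> b) \<odot> x"

lemma polar_rep_same: "polar_rep a a = quadratic_rep (\<odot>) a"
  by (rule ext) (simp add: polar_rep_def quadratic_rep_def scaleR_2)

lemma polar_rep_unit: "polar_rep a e = lyapunov (\<odot>) a"
  by (rule ext) (simp add: polar_rep_def lyapunov_def)

lemma polar_rep_unit_arg: "polar_rep a b e = a \<odot> b"
  by (simp add: polar_rep_def jprod_commute)

lemma polar_rep_commute: "polar_rep a b x = polar_rep b a x"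
  by (simp add: polar_rep_def jprod_commute)

lemma inner_polar_rep: "inner (polar_rep a b x) y = inner x (polar_rep a b y)"
  by (simp add: polar_rep_def inner_simps) (simp add: inner_jprod)

text \<open>By associativity of the inner product, both sides are \<open>inner (x \<odot> b) (y
  \<odot> a) + inner (x \<odot> a) (y \<odot> b) - inner (a \<odot> b) (x \<odot> y)\<close>. The
  symmetry carries a bound in the last argument over to the first two.\<close>

lemma inner_polar_rep_swap: "inner (polar_rep a b x) y = inner (polar_rep x y a) b"
proof -
  have "inner (a \<odot> (b \<odot> x)) y = inner (x \<odot> b) (y \<odot> a)"
    "inner (b \<odot> (a \<odot> x)) y = inner (x \<odot> a) (y \<odot> b)"
    "inner ((a \<odot> b) \<odot> x) y = inner (a \<odot> b) (x \<odot> y)"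
    by (metis inner_jprod inner_jprod_shift jprod_commute)+
  moreover have "inner (x \<odot> (y \<odot> a)) b = inner (x \<odot> b) (y \<odot> a)"
    "inner (y \<odot> (x \<odot> a)) b = inner (x \<odot> a) (y \<odot> b)"
    "inner ((x \<odot> y) \<odot> a) b = inner (a \<odot> b) (x \<odot> y)"
    by (metis inner_jprod inner_jprod_shift jprod_commute inner_commute)+
  ultimately show ?thesis by (simp add: polar_rep_def inner_simps)
qed

lemma linear_polar_rep:
  "linear (\<lambda>a. polar_rep a b x)" "linear (\<lambda>b. polar_rep a b x)" "linear (\<lambda>x. polar_rep a b x)"
  by (rule linearI; simp add: polar_rep_def jprod_simps algebra_simps)+

section \<open>Uniqueness of eigenvalues\<close>

text \<open>Replaces the two lists by a coefficient function on a frame, so that uniqueness becomes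
  an equation between multisets.\<close>

lemma spectral_decompositionD:
  assumes "spectral_decomposition (\<odot>) e x xs es"
  obtains F \<phi> where "jordan_frame (\<odot>) e F" "x = (\<Sum>c\<in>F. \<phi> c *\<^sub>R c)"
    "mset xs = image_mset \<phi> (mset_set F)"
proof -
  have d: "distinct es" and F: "jordan_frame (\<odot>) e (set es)" and l: "length xs = length es"
    and x: "x = (\<Sum>i<length es. (xs ! i) *\<^sub>R (es ! i))"
    using assms by (auto simp: spectral_decomposition_def)
  define \<phi> where "\<phi> = the \<circ> map_of (zip es xs)"
  have \<phi>: "\<phi> (es ! i) = xs ! i" if "i < length es" for i
    using that d l by (simp add: \<phi>_def map_of_zip_nth)
  have "x = (\<Sum>i<length es. \<phi> (es ! i) *\<^sub>R (es ! i))"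
    unfolding x by (intro sum.cong) (auto simp: \<phi>)
  also have "\<dots> = (\<Sum>c\<in>set es. \<phi> c *\<^sub>R c)"
    by (rule sum.reindex_bij_betw[OF bij_betw_nth]) (use d in auto)
  finally have "x = (\<Sum>c\<in>set es. \<phi> c *\<^sub>R c)" .
  moreover have "map \<phi> es = xs" using l \<phi> by (auto intro: nth_equalityI)
  then have "mset xs = image_mset \<phi> (mset_set (set es))"
    by (metis d mset_map mset_set_set)
  ultimately show thesis using that F by blast
qed

lemma spectral_decomposition_sorted:
  assumes F: "jordan_frame (\<odot>) e F" and x: "x = (\<Sum>c\<in>F. \<phi> c *\<^sub>R c)"
  obtains xs es where "sorted_wrt (\<ge>) xs" "spectral_decomposition (\<odot>) e x xs es"
proof -
  obtain es0 where es0: "set es0 = F" "distinct es0" using finite_distinct_list frameD(1)[OF F] by blast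
  define es where "es = rev (sort_key \<phi> es0)"
  have es: "set es = F" "distinct es" using es0 by (auto simp: es_def)
  have "sorted_wrt (\<ge>) (map \<phi> es)"
    by (simp add: es_def rev_map[symmetric] sorted_wrt_rev)
  moreover have "(\<Sum>c\<in>F. \<phi> c *\<^sub>R c) = (\<Sum>i<length es. \<phi> (es ! i) *\<^sub>R (es ! i))"
    by (rule sum.reindex_bij_betw[OF bij_betw_nth, symmetric]) (use es in auto)
  then have "spectral_decomposition (\<odot>) e x (map \<phi> es) es"
    using es F x by (simp add: spectral_decomposition_def)
  ultimately show thesis using that by blast
qed

lemma sorted_desc_unique:
  fixes xs ys :: "real list"
  assumes "sorted_wrt (\<ge>) xs" "sorted_wrt (\<ge>) ys" "mset xs = mset ys"
  shows "xs = ys"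
proof -
  have "sorted (rev xs)" "sorted (rev ys)" using assms by (auto simp: sorted_wrt_rev)
  then have "rev xs = rev ys" using assms(3) by (metis mset_rev properties_for_sort)
  then show ?thesis by simp
qed

text \<open>The description operator in \<open>eigenvalues\<close> needs uniqueness. It is a premise
  here because it is first available for distinct coefficients only and later for all
  elements.\<close>

lemma mset_eigenvalues_if_unique:
  assumes F: "jordan_frame (\<odot>) e F" and x: "x = (\<Sum>c\<in>F. \<phi> c *\<^sub>R c)"
    and unique: "\<And>G \<psi>. jordan_frame (\<odot>) e G \<Longrightarrow> x = (\<Sum>c\<in>G. \<psi> c *\<^sub>R c) \<Longrightarrow>
      image_mset \<psi> (mset_set G) = image_mset \<phi> (mset_set F)"
  shows "mset (eigenvalues (\<odot>) e x) = image_mset \<phi> (mset_set F)"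
proof -
  have *: "mset ys = image_mset \<phi> (mset_set F)" if "spectral_decomposition (\<odot>) e x ys es" for ys es
    using that unique by (metis spectral_decompositionD)
  obtain xs es where xs: "sorted_wrt (\<ge>) xs" "spectral_decomposition (\<odot>) e x xs es"
    using spectral_decomposition_sorted[OF F x] by blast
  have "eigenvalues (\<odot>) e x = xs"
    unfolding eigenvalues_def
  proof (rule the_equality)
    show "sorted_wrt (\<ge>) xs \<and> (\<exists>es. spectral_decomposition (\<odot>) e x xs es)" using xs by blast
  next
    fix ys assume "sorted_wrt (\<ge>) ys \<and> (\<exists>es. spectral_decomposition (\<odot>) e x ys es)"
    then show "ys = xs" using xs * by (intro sorted_desc_unique) auto
  qed
  then show ?thesis using * xs by blast
qed

text \<open>Members of both frames are eigenvectors of the same symmetric multiplication operator,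
  with eigenvalues \<open>\<phi> c\<close> and \<open>\<psi> d\<close>.\<close>

lemma frames_inner_eq_0:
  assumes F: "jordan_frame (\<odot>) e F" and G: "jordan_frame (\<odot>) e G"
    and eq: "(\<Sum>c\<in>F. \<phi> c *\<^sub>R c) = (\<Sum>c\<in>G. \<psi> c *\<^sub>R c)" and "c \<in> F" "d \<in> G" "\<phi> c \<noteq> \<psi> d"
  shows "inner c d = 0"
proof -
  let ?x = "\<Sum>c\<in>F. \<phi> c *\<^sub>R c"
  have "c \<odot> ?x = \<phi> c *\<^sub>R c" using frame_jprod_sum[OF F \<open>c \<in> F\<close>] .
  moreover have "d \<odot> ?x = \<psi> d *\<^sub>R d" unfolding eq using frame_jprod_sum[OF G \<open>d \<in> G\<close>] .
  ultimately have "\<phi> c * inner c d = \<psi> d * inner c d"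
    using inner_jprod_shift[of c ?x d] jprod_commute[of ?x d] by simp
  then show ?thesis using assms(6) by simp
qed

text \<open>Since \<open>inner e d\<close> is nonzero, each \<open>d\<close> in \<open>G\<close>
  meets some \<open>c\<close> in \<open>F\<close>, and then \<open>\<phi> c = \<psi> d\<close>. By
  injectivity all other members of \<open>F\<close> are orthogonal to \<open>d\<close>, so
  \<open>c \<odot> d = d\<close> and \<open>d = c\<close>. Thus \<open>G\<close> lies in
  \<open>F\<close>, and the equal sums leave nothing over.\<close>

lemma distinct_coefficients_unique:
  assumes F: "jordan_frame (\<odot>) e F" and inj: "inj_on \<phi> F"
    and G: "jordan_frame (\<odot>) e G" and eq: "(\<Sum>c\<in>F. \<phi> c *\<^sub>R c) = (\<Sum>c\<in>G. \<psi> c *\<^sub>R c)"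
  shows "image_mset \<psi> (mset_set G) = image_mset \<phi> (mset_set F)"
proof -
  have *: "d \<in> F \<and> \<psi> d = \<phi> d" if d: "d \<in> G" for d
  proof -
    have "(\<Sum>c\<in>F. inner c d) = inner e d" using frameD(6)[OF F] by (simp add: inner_sum_left[symmetric])
    also have "\<dots> \<noteq> 0" using inner_idempotent_unit[of d] frameD[OF G] d by (simp add: inner_commute)
    finally obtain c where c: "c \<in> F" "inner c d \<noteq> 0" by (meson sum.neutral)
    then have \<phi>c: "\<phi> c = \<psi> d" using frames_inner_eq_0[OF F G eq _ d] by blast
    have "c' \<odot> d = 0" if "c' \<in> F - {c}" for c'
    proof (rule idempotents_orthogonal)
      show "inner c' d = 0"
        using frames_inner_eq_0[OF F G eq, of c' d] that d c inj_onD[OF inj, of c' c] \<phi>c by auto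
    qed (use that d frameD[OF F] frameD[OF G] in auto)
    then have "(\<Sum>c'\<in>F. c' \<odot> d) = c \<odot> d"
      using c frameD(1)[OF F] by (simp add: sum.remove)
    then have "c \<odot> d = d"
      using frameD(6)[OF F] by (simp add: jprod_sum_left[symmetric])
    then have "d = c"
      using primitive_dominates[of c d] frameD[OF F] frameD[OF G] c d by blast
    then show ?thesis using c \<phi>c by simp
  qed
  have "F = G"
  proof (rule ccontr)
    assume "F \<noteq> G"
    then obtain c where c: "c \<in> F - G" using * by blast
    have GF: "G \<subseteq> F" using * by blast
    have "\<Sum>(F - G) = 0"
      using frameD(6)[OF F] frameD(6)[OF G] sum_diff[OF frameD(1)[OF F] GF, of "\<lambda>x. x"] by simp
    then have "c \<odot> \<Sum>(F - G) = 0" by simp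
    moreover have "c \<odot> \<Sum>(F - G) = (\<Sum>d\<in>F - G. if d = c then c else 0)"
      unfolding jprod_sum_right using c frameD[OF F] by (intro sum.cong) auto
    ultimately have "c = 0" using c frameD(1)[OF F] by simp
    then show False using c frameD(4)[OF F] by blast
  qed
  then show ?thesis using * frameD(1)[OF F] by (auto intro!: image_mset_cong)
qed

end

locale euclidean_jordan_algebra_trace = euclidean_jordan_algebra +
  assumes inner_eq_trace: "inner x y = jordan_trace (\<odot>) e (x \<odot> y)"
begin

text \<open>
  The trace hypothesis, evaluated only at elements with distinct coefficients, where the
  eigenvalues are unique for free, forces primitive idempotents to be unit vectors; this in turn
  makes multiplicities, and hence eigenvalues of arbitrary elements, unique.
\<close>

lemma inner_primitive_unit:
  assumes c: "primitive_idempotent (\<odot>) c"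
  shows "inner c e = 1"
proof -
  obtain F where F: "jordan_frame (\<odot>) e F" and cF: "c \<in> F" using primitive_in_frame[OF c] by blast
  note fin = frameD(1)[OF F]
  obtain h :: "'a \<Rightarrow> nat" where h: "inj_on h F" using finite_imp_inj_to_nat_seg[OF fin] by metis
  have tr: "inner (\<Sum>d\<in>F. \<phi> d *\<^sub>R d) e = sum \<phi> F" if "inj_on \<phi> F" for \<phi>
  proof -
    let ?x = "\<Sum>d\<in>F. \<phi> d *\<^sub>R d"
    have "mset (eigenvalues (\<odot>) e ?x) = image_mset \<phi> (mset_set F)"
      using distinct_coefficients_unique[OF F that] by (intro mset_eigenvalues_if_unique[OF F refl]) auto
    then have "sum_list (eigenvalues (\<odot>) e ?x) = sum \<phi> F"
      by (metis sum_mset_sum_list sum_unfold_sum_mset)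
    then show ?thesis using inner_eq_trace[of ?x e] by (simp add: jordan_trace_def)
  qed
  \<comment> \<open>Distinct integers remain distinct when the one at \<open>c\<close> is raised by
    1/2. The coefficient sum then grows by 1/2, the inner product with \<open>e\<close> by
    \<open>inner c e / 2\<close>.\<close>
  define \<phi> where "\<phi> = (\<lambda>d. real (h d))"
  define \<psi> where "\<psi> = (\<lambda>d. real (h d) + (if d = c then 1/2 else 0))"
  have "inj_on \<phi> F" using h by (auto simp: \<phi>_def inj_on_def)
  moreover have "inj_on \<psi> F"
  proof (rule inj_onI)
    fix u v assume uv: "u \<in> F" "v \<in> F" "\<psi> u = \<psi> v"
    then have "2 * real (h u) + (if u = c then 1 else 0) = 2 * real (h v) + (if v = c then 1 else 0)"
      by (auto simp: \<psi>_def split: if_splits)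
    then have "real (2 * h u + (if u = c then 1 else 0)) = real (2 * h v + (if v = c then 1 else 0))"
      by (simp only: of_nat_add of_nat_mult of_nat_numeral of_nat_1 of_nat_0 if_distrib[of real])
    then have "2 * h u + (if u = c then 1 else 0) = 2 * h v + (if v = c then 1 else 0)"
      by (rule of_nat_eq_iff[THEN iffD1])
    then have "h u = h v" by (auto split: if_splits)
    then show "u = v" using h uv by (auto dest: inj_onD)
  qed
  moreover have "(\<Sum>d\<in>F. \<psi> d *\<^sub>R d) = (\<Sum>d\<in>F. \<phi> d *\<^sub>R d) + (\<Sum>d\<in>F. (if d = c then (1/2) *\<^sub>R c else 0))"
    unfolding sum.distrib[symmetric] by (intro sum.cong) (auto simp: \<phi>_def \<psi>_def scaleR_left_distrib)
  then have "(\<Sum>d\<in>F. \<psi> d *\<^sub>R d) = (\<Sum>d\<in>F. \<phi> d *\<^sub>R d) + (1/2) *\<^sub>R c"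
    using fin cF by simp
  moreover have "sum \<psi> F = sum \<phi> F + 1/2"
    using fin cF by (simp add: \<phi>_def \<psi>_def sum.distrib)
  ultimately show ?thesis using tr[of \<phi>] tr[of \<psi>] by (simp add: inner_add_left)
qed

text \<open>Every member of a frame contributes 1 to \<open>inner e e\<close>, so all frames have
  the same size and the description in \<open>jordan_rank\<close> is meaningful.\<close>

lemma card_frame:
  assumes F: "jordan_frame (\<odot>) e F"
  shows "card F = jordan_rank (\<odot>) e"
proof -
  have *: "real (card G) = inner e e" if G: "jordan_frame (\<odot>) e G" for G
  proof -
    have "inner e e = (\<Sum>c\<in>G. inner c e)" using frameD(6)[OF G] by (simp add: inner_sum_left[symmetric])
    then show ?thesis using inner_primitive_unit frameD(2)[OF G] by simp
  qed
  have "(THE n. \<exists>F. jordan_frame (\<odot>) e F \<and> card F = n) = card F"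
  proof (rule the_equality)
    show "\<exists>G. jordan_frame (\<odot>) e G \<and> card G = card F" using F by blast
  next
    fix m assume "\<exists>G. jordan_frame (\<odot>) e G \<and> card G = m"
    then obtain G where "jordan_frame (\<odot>) e G" "card G = m" by blast
    then have "real m = real (card F)" using *[OF F] * by metis
    then show "m = card F" by simp
  qed
  then show ?thesis by (simp add: jordan_rank_def)
qed

text \<open>For \<open>c\<close> in \<open>F\<close>, the numbers \<open>inner c d\<close> over
  \<open>G\<close> add up to \<open>inner c e = 1\<close>. So the multiplicity of \<open>t\<close>
  is a double sum over pairs from both frames, and pairs with nonzero inner product have equal
  coefficients, which makes the double sum symmetric.\<close>

lemma mset_eigenvalues:
  assumes F: "jordan_frame (\<odot>) e F" and x: "x = (\<Sum>c\<in>F. \<phi> c *\<^sub>R c)"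
  shows "mset (eigenvalues (\<odot>) e x) = image_mset \<phi> (mset_set F)"
proof (rule mset_eigenvalues_if_unique[OF F x])
  fix G \<psi> assume G: "jordan_frame (\<odot>) e G" and xG: "x = (\<Sum>c\<in>G. \<psi> c *\<^sub>R c)"
  have count: "real (count (image_mset \<phi> (mset_set F)) t) =
      (\<Sum>c\<in>F. \<Sum>d\<in>G. if \<phi> c = t then inner c d else 0)"
    if F: "jordan_frame (\<odot>) e F" and G: "jordan_frame (\<odot>) e G" for F G \<phi> t
  proof -
    have "real (count (image_mset \<phi> (mset_set F)) t) = (\<Sum>c\<in>F. if \<phi> c = t then 1 else 0)"
      using frameD(1)[OF F]
      by (simp add: count_image_mset' sum.If_cases Int_def conj_commute eq_commute)
    also have "\<dots> = (\<Sum>c\<in>F. \<Sum>d\<in>G. if \<phi> c = t then inner c d else 0)"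
    proof (rule sum.cong[OF refl])
      fix c assume "c \<in> F"
      then have "(\<Sum>d\<in>G. inner c d) = 1"
        using inner_primitive_unit frameD(2)[OF F] frameD(6)[OF G] by (simp add: inner_sum_right[symmetric])
      then show "(if \<phi> c = t then 1 else 0) = (\<Sum>d\<in>G. if \<phi> c = t then inner c d else 0)" by simp
    qed
    finally show ?thesis .
  qed
  show "image_mset \<psi> (mset_set G) = image_mset \<phi> (mset_set F)"
  proof (rule multiset_eqI)
    fix t
    have "real (count (image_mset \<psi> (mset_set G)) t) =
        (\<Sum>c\<in>G. \<Sum>d\<in>F. if \<psi> c = t then inner c d else 0)"
      by (rule count[OF G F])
    also have "\<dots> = (\<Sum>d\<in>F. \<Sum>c\<in>G. if \<psi> c = t then inner c d else 0)"
      by (rule sum.swap)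
    also have "\<dots> = (\<Sum>d\<in>F. \<Sum>c\<in>G. if \<phi> d = t then inner d c else 0)"
    proof (intro sum.cong refl)
      fix d c assume "d \<in> F" "c \<in> G"
      then show "(if \<psi> c = t then inner c d else 0) = (if \<phi> d = t then inner d c else 0)"
        using frames_inner_eq_0[OF F G, of \<phi> \<psi> d c] x xG by (auto simp: inner_commute)
    qed
    also have "\<dots> = real (count (image_mset \<phi> (mset_set F)) t)"
      by (rule count[OF F G, symmetric])
    finally show "count (image_mset \<psi> (mset_set G)) t = count (image_mset \<phi> (mset_set F)) t" by simp
  qed
qed

section \<open>Layers and the multilinear inequality\<close>

lemma spectral_norm_eq:
  assumes "jordan_frame (\<odot>) e F" "x = (\<Sum>c\<in>F. \<phi> c *\<^sub>R c)"
  shows "spectral_norm (\<odot>) e p x = lp p F \<phi>"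
  unfolding spectral_norm_def
  by (rule lp_norm_eq_lp[OF mset_eigenvalues[OF assms] frameD(1)[OF assms(1)]])

text \<open>The typical case is a signed sum of at most \<open>m\<close> members of a frame.\<close>

definition layer :: "nat \<Rightarrow> 'a \<Rightarrow> bool" where
  "layer m u \<longleftrightarrow> (\<exists>F \<phi>. jordan_frame (\<odot>) e F \<and> u = (\<Sum>c\<in>F. \<phi> c *\<^sub>R c) \<and>
     (\<forall>c\<in>F. \<bar>\<phi> c\<bar> \<le> 1) \<and> (\<Sum>c\<in>F. \<bar>\<phi> c\<bar>) \<le> real m)"

lemma layer_square_le:
  assumes u: "layer m u" and c: "primitive_idempotent (\<odot>) c"
  shows "inner (u \<odot> u) c \<le> 1"
proof -
  obtain F \<phi> where F: "jordan_frame (\<odot>) e F" and u: "u = (\<Sum>c\<in>F. \<phi> c *\<^sub>R c)"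
    and \<phi>: "\<And>c. c \<in> F \<Longrightarrow> \<bar>\<phi> c\<bar> \<le> 1"
    using u by (auto simp: layer_def)
  have "inner (u \<odot> u) c = (\<Sum>d\<in>F. (\<phi> d * \<phi> d) * inner d c)"
    unfolding u frame_sum_jprod_sum[OF F] by (simp add: inner_sum_left)
  also have "\<dots> \<le> (\<Sum>d\<in>F. inner d c)"
  proof (rule sum_mono)
    fix d assume d: "d \<in> F"
    have "0 \<le> inner d c" using inner_idempotents_nonneg frameD(3)[OF F d] primitiveD[OF c] by blast
    moreover have "\<phi> d * \<phi> d \<le> 1" using \<phi>[OF d] abs_square_le_1[of "\<phi> d"] by (simp add: power2_eq_square)
    ultimately show "\<phi> d * \<phi> d * inner d c \<le> inner d c" by (simp add: mult_left_le_one_le)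
  qed
  also have "\<dots> = 1" using inner_primitive_unit[OF c] frameD(6)[OF F]
    by (simp add: inner_sum_left[symmetric] inner_commute)
  finally show ?thesis .
qed

lemma polar_rep_primitive_bound:
  assumes f: "primitive_idempotent (\<odot>) f" and c: "c \<odot> c = c"
  shows "\<bar>inner (polar_rep a b f) c\<bar> \<le> (inner (polar_rep a a f) c + inner (polar_rep b b f) c) / 2"
proof -
  have "0 \<le> inner (polar_rep (a + b) (a + b) f) c" "0 \<le> inner (polar_rep (a - b) (a - b) f) c"
    using quadratic_rep_nonneg[OF f c] by (simp_all add: polar_rep_same)
  moreover have "inner (polar_rep (a + b) (a + b) f) c
      = inner (polar_rep a a f) c + inner (polar_rep b b f) c + 2 * inner (polar_rep a b f) c"
    using polar_rep_commute[of b a f]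
    by (simp add: linear_add[OF linear_polar_rep(1)] linear_add[OF linear_polar_rep(2)] inner_simps)
  moreover have "inner (polar_rep (a - b) (a - b) f) c
      = inner (polar_rep a a f) c + inner (polar_rep b b f) c - 2 * inner (polar_rep a b f) c"
    using polar_rep_commute[of b a f]
    by (simp add: linear_diff[OF linear_polar_rep(1)] linear_diff[OF linear_polar_rep(2)] inner_simps)
  moreover have "\<bar>t\<bar> \<le> (u + v) / 2" if "0 \<le> u + v + 2 * t" "0 \<le> u + v - 2 * t" for t u v :: real
    using that by (simp add: abs_le_iff)
  ultimately show ?thesis by metis
qed

lemma polar_rep_layer_bound_primitive:
  assumes a: "layer j a" and b: "layer k b" and x: "layer l x" and c: "primitive_idempotent (\<odot>) c"
  shows "\<bar>inner (polar_rep a b x) c\<bar> \<le> 1"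
proof -
  note cc = primitiveD(1)[OF c]
  obtain F \<phi> where F: "jordan_frame (\<odot>) e F" and x: "x = (\<Sum>c\<in>F. \<phi> c *\<^sub>R c)"
    and \<phi>: "\<And>c. c \<in> F \<Longrightarrow> \<bar>\<phi> c\<bar> \<le> 1"
    using x by (auto simp: layer_def)
  \<comment> \<open>The frame sums to \<open>e\<close>, and \<open>polar_rep u u e\<close> is the
    square of \<open>u\<close>, so the diagonal terms add up to at most 1.\<close>
  have diag: "(\<Sum>d\<in>F. inner (polar_rep u u d) c) \<le> 1" if "layer i u" for i u
  proof -
    have "(\<Sum>d\<in>F. inner (polar_rep u u d) c) = inner (polar_rep u u e) c"
      using frameD(6)[OF F] linear_sum[OF linear_polar_rep(3), of u u "\<lambda>x. x" F]
      by (simp add: inner_sum_left)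
    then show ?thesis using layer_square_le[OF that c] by (simp add: polar_rep_unit_arg)
  qed
  have "inner (polar_rep a b x) c = (\<Sum>d\<in>F. \<phi> d * inner (polar_rep a b d) c)"
    unfolding x by (simp add: linear_sum[OF linear_polar_rep(3)] linear_cmul[OF linear_polar_rep(3)] inner_sum_left)
  also have "\<bar>\<dots>\<bar> \<le> (\<Sum>d\<in>F. \<bar>\<phi> d * inner (polar_rep a b d) c\<bar>)" by (rule sum_abs)
  also have "\<dots> \<le> (\<Sum>d\<in>F. (inner (polar_rep a a d) c + inner (polar_rep b b d) c) / 2)"
  proof (rule sum_mono)
    fix d assume d: "d \<in> F"
    have "\<bar>\<phi> d * inner (polar_rep a b d) c\<bar> \<le> \<bar>inner (polar_rep a b d) c\<bar>"
      using \<phi>[OF d] by (simp add: abs_mult mult_left_le_one_le)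
    also have "\<dots> \<le> (inner (polar_rep a a d) c + inner (polar_rep b b d) c) / 2"
      by (rule polar_rep_primitive_bound[OF frameD(2)[OF F d] cc])
    finally show "\<bar>\<phi> d * inner (polar_rep a b d) c\<bar> \<le> (inner (polar_rep a a d) c + inner (polar_rep b b d) c) / 2" .
  qed
  also have "\<dots> \<le> 1"
    using diag[OF a] diag[OF b] by (simp add: sum_divide_distrib[symmetric] sum.distrib)
  finally show ?thesis .
qed

lemma polar_rep_layer_bound_last:
  assumes a: "layer j a" and b: "layer k b" and x: "layer l x" and y: "layer m y"
  shows "\<bar>inner (polar_rep a b x) y\<bar> \<le> real m"
proof -
  obtain F \<phi> where F: "jordan_frame (\<odot>) e F" and y: "y = (\<Sum>c\<in>F. \<phi> c *\<^sub>R c)"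
    and \<phi>: "(\<Sum>c\<in>F. \<bar>\<phi> c\<bar>) \<le> real m"
    using y by (auto simp: layer_def)
  have "\<bar>inner (polar_rep a b x) y\<bar> \<le> (\<Sum>c\<in>F. \<bar>\<phi> c * inner (polar_rep a b x) c\<bar>)"
    unfolding y by (simp add: inner_sum_right sum_abs)
  also have "\<dots> \<le> (\<Sum>c\<in>F. \<bar>\<phi> c\<bar>)"
    using polar_rep_layer_bound_primitive[OF a b x frameD(2)[OF F]]
    by (intro sum_mono) (simp add: abs_mult mult_left_le)
  finally show ?thesis using \<phi> by simp
qed

text \<open>Provides the bound by the rank, needed because \<open>m\<close> may exceed the range of
  the index sum in \<open>polar_rep_layer_bound\<close>.\<close>

lemma layer_rank: "layer m u \<Longrightarrow> layer (jordan_rank (\<odot>) e) u"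
proof -
  assume "layer m u"
  then obtain F \<phi> where F: "jordan_frame (\<odot>) e F" "u = (\<Sum>c\<in>F. \<phi> c *\<^sub>R c)" "\<forall>c\<in>F. \<bar>\<phi> c\<bar> \<le> 1"
    by (auto simp: layer_def)
  moreover have "(\<Sum>c\<in>F. \<bar>\<phi> c\<bar>) \<le> real (card F)"
    using F(3) sum_bounded_above[of F "\<lambda>c. \<bar>\<phi> c\<bar>" 1] by simp
  ultimately show ?thesis using card_frame by (auto simp: layer_def)
qed

lemma layer_unit: "layer (jordan_rank (\<odot>) e) e"
proof -
  obtain F \<phi> where F: "jordan_frame (\<odot>) e F" "e = (\<Sum>c\<in>F. \<phi> c *\<^sub>R c)"
    using spectral_theorem by blast
  then show ?thesis
    using card_frame frameD(6)[OF F(1)] unfolding layer_def by (intro exI[of _ F] exI[of _ "\<lambda>_. 1"]) auto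
qed

text \<open>The sum counts the indices below the minimum of \<open>j, k, l, m\<close> and the rank;
  the symmetries of the form turn the bound by \<open>m\<close> into one for each argument. The
  nesting of the product allows the arguments to be treated one after another.\<close>

lemma polar_rep_layer_bound:
  assumes a: "layer j a" and b: "layer k b" and x: "layer l x" and y: "layer m y"
  shows "\<bar>inner (polar_rep a b x) y\<bar>
    \<le> (\<Sum>i<jordan_rank (\<odot>) e. of_bool (i < j) * (of_bool (i < k) * (of_bool (i < l) * of_bool (i < m))))"
proof -
  let ?n = "jordan_rank (\<odot>) e"
  have "\<bar>inner (polar_rep a b x) y\<bar> \<le> real m" "\<bar>inner (polar_rep a b x) y\<bar> \<le> real ?n"
    using polar_rep_layer_bound_last[OF a b x y] polar_rep_layer_bound_last[OF a b x layer_rank[OF y]] .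
  moreover have "\<bar>inner (polar_rep a b x) y\<bar> \<le> real l"
    using polar_rep_layer_bound_last[OF a b y x]
    unfolding inner_polar_rep[of a b y x] by (simp add: inner_commute)
  moreover have "\<bar>inner (polar_rep a b x) y\<bar> \<le> real k"
    using polar_rep_layer_bound_last[OF x y a b] by (simp add: inner_polar_rep_swap)
  moreover have "\<bar>inner (polar_rep a b x) y\<bar> \<le> real j"
    using polar_rep_layer_bound_last[OF x y b a]
    by (simp add: inner_polar_rep_swap[of b a, symmetric] polar_rep_commute)
  ultimately have "\<bar>inner (polar_rep a b x) y\<bar> \<le> real (min ?n (min j (min k (min l m))))"
    by (simp add: min_def)
  also have "\<dots> = (\<Sum>i<min ?n (min j (min k (min l m))). 1)" by simp
  also have "\<dots> = (\<Sum>i<?n. of_bool (i < j) * (of_bool (i < k) * (of_bool (i < l) * of_bool (i < m))))"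
    by (rule sum.mono_neutral_cong_left) auto
  finally show ?thesis .
qed

section \<open>Sequences of moduli and reduction to layers\<close>

abbreviation "snorm \<equiv> spectral_norm (\<odot>) e"
abbreviation "indices \<equiv> {..<jordan_rank (\<odot>) e}"

text \<open>
  Records what is needed of the decreasing list of moduli of the eigenvalues: its norms, and that
  bounds for a linear functional on layers add up with weights \<open>A\<close>.
\<close>

definition modulus_sequence :: "'a \<Rightarrow> (nat \<Rightarrow> real) \<Rightarrow> bool" where
  "modulus_sequence x A \<longleftrightarrow> (\<forall>p. snorm p x = lp p indices A) \<and> (\<forall>i. 0 \<le> A i) \<and>
     (\<forall>f w. linear f \<longrightarrow> (\<forall>j u. layer j u \<longrightarrow> \<bar>f u\<bar> \<le> (\<Sum>i\<in>indices. of_bool (i < j) * w i)) \<longrightarrow>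
       \<bar>f x\<bar> \<le> (\<Sum>i\<in>indices. A i * w i))"

text \<open>Abel summation over a frame sorted by decreasing modulus of the coefficients.\<close>

lemma layer_cake:
  obtains A where "modulus_sequence x A" "\<And>p. snorm p (x \<odot> x) = lp p indices (\<lambda>i. A i * A i)"
proof -
  obtain F \<phi> where F: "jordan_frame (\<odot>) e F" and x: "x = (\<Sum>c\<in>F. \<phi> c *\<^sub>R c)"
    using spectral_theorem by blast
  let ?n = "jordan_rank (\<odot>) e"
  obtain es0 where es0: "set es0 = F" "distinct es0" using finite_distinct_list frameD(1)[OF F] by blast
  define es where "es = sort_key (\<lambda>c. - \<bar>\<phi> c\<bar>) es0"
  have es: "set es = F" "distinct es" using es0 by (auto simp: es_def)
  have len: "length es = ?n" using es card_frame[OF F] distinct_card by metis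
  have bij: "bij_betw (\<lambda>i. es ! i) {..<?n} F"
    using bij_betw_nth[OF es(2), of "{..<?n}" F] es len by simp
  \<comment> \<open>The value 0 from the rank onwards makes the telescoping sum of differences end
    without a remainder.\<close>
  define A where "A i = (if i < ?n then \<bar>\<phi> (es ! i)\<bar> else 0)" for i
  have anti: "A (Suc i) \<le> A i" for i
  proof -
    have "sorted (map (\<lambda>c. - \<bar>\<phi> c\<bar>) es)" by (simp add: es_def)
    then have "- \<bar>\<phi> (es ! i)\<bar> \<le> - \<bar>\<phi> (es ! Suc i)\<bar>" if "Suc i < ?n"
      using that len sorted_nth_mono[of "map (\<lambda>c. - \<bar>\<phi> c\<bar>) es" i "Suc i"] by simp
    then show ?thesis by (auto simp: A_def)
  qed
  \<comment> \<open>\<open>U k\<close> collects the signs of the \<open>k + 1\<close> largest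
    coefficients, hence a layer for \<open>Suc k\<close>; weighting with the drops of
    \<open>A\<close> recovers \<open>x\<close>.\<close>
  define \<psi> where "\<psi> k c = (if c \<in> set (take (Suc k) es) then sgn (\<phi> c) else 0)" for k c
  define U where "U k = (\<Sum>c\<in>F. \<psi> k c *\<^sub>R c)" for k
  have layerU: "layer (Suc k) (U k)" for k
  proof -
    have "(\<Sum>c\<in>F. \<bar>\<psi> k c\<bar>) \<le> (\<Sum>c\<in>F. if c \<in> set (take (Suc k) es) then 1 else 0)"
      by (intro sum_mono) (auto simp: \<psi>_def abs_sgn_eq)
    also have "\<dots> = real (card (F \<inter> set (take (Suc k) es)))"
      using frameD(1)[OF F] by (simp add: sum.If_cases)
    also have "\<dots> \<le> real (Suc k)"
    proof -
      have "card (F \<inter> set (take (Suc k) es)) \<le> card (set (take (Suc k) es))"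
        by (intro card_mono) auto
      also have "\<dots> \<le> length (take (Suc k) es)" by (rule card_length)
      also have "\<dots> \<le> Suc k" by simp
      finally show ?thesis by simp
    qed
    finally have "(\<Sum>c\<in>F. \<bar>\<psi> k c\<bar>) \<le> real (Suc k)" .
    moreover have "\<bar>\<psi> k c\<bar> \<le> 1" for c by (simp add: \<psi>_def abs_sgn_eq)
    ultimately show ?thesis using F unfolding layer_def U_def by blast
  qed
  have tele: "(\<Sum>k<?n. (A k - A (Suc k)) * of_bool (i \<le> k)) = A i" if "i < ?n" for i
  proof -
    have "(\<Sum>k<?n. (A k - A (Suc k)) * of_bool (i \<le> k)) = (\<Sum>k\<in>{i..<?n}. A k - A (Suc k))"
      by (rule sum.mono_neutral_cong_right) auto
    also have "\<dots> = - (\<Sum>k\<in>{i..<?n}. A (Suc k) - A k)" by (simp add: sum_negf[symmetric])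
    also have "\<dots> = A i - A ?n" using that by (subst sum_Suc_diff') auto
    finally show ?thesis by (simp add: A_def)
  qed
  have coef: "(\<Sum>k<?n. (A k - A (Suc k)) * \<psi> k c) = \<phi> c" if c: "c \<in> F" for c
  proof -
    have "c \<in> set es" using c es by simp
    then obtain i where i: "i < ?n" "c = es ! i" using len by (metis in_set_conv_nth)
    have "c \<in> set (take (Suc k) es) \<longleftrightarrow> i \<le> k" for k
    proof
      assume "c \<in> set (take (Suc k) es)"
      then obtain i' where "i' < length (take (Suc k) es)" "take (Suc k) es ! i' = c"
        by (metis in_set_conv_nth)
      then have "i' < Suc k" "i' < ?n" "es ! i' = es ! i" using i len by auto
      then show "i \<le> k" using es(2) i len by (simp add: nth_eq_iff_index_eq)
    next
      assume "i \<le> k"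
      then show "c \<in> set (take (Suc k) es)" using i len by (auto simp: in_set_conv_nth intro!: exI[of _ i])
    qed
    then have "(\<Sum>k<?n. (A k - A (Suc k)) * \<psi> k c) = (\<Sum>k<?n. (A k - A (Suc k)) * of_bool (i \<le> k)) * sgn (\<phi> c)"
      unfolding sum_distrib_right by (intro sum.cong) (auto simp: \<psi>_def)
    then show ?thesis using tele[OF i(1)] i by (simp add: A_def abs_mult_sgn)
  qed
  have xU: "x = (\<Sum>k<?n. (A k - A (Suc k)) *\<^sub>R U k)"
  proof -
    have "(\<Sum>k<?n. (A k - A (Suc k)) *\<^sub>R U k) = (\<Sum>c\<in>F. \<Sum>k<?n. ((A k - A (Suc k)) * \<psi> k c) *\<^sub>R c)"
      unfolding U_def scaleR_sum_right by (subst sum.swap) simp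
    also have "\<dots> = x" unfolding x by (simp add: scaleR_sum_left[symmetric] coef)
    finally show ?thesis by simp
  qed
  have "\<bar>f x\<bar> \<le> (\<Sum>i<?n. A i * w i)"
    if f: "linear f" and bound: "\<forall>j u. layer j u \<longrightarrow> \<bar>f u\<bar> \<le> (\<Sum>i<?n. of_bool (i < j) * w i)"
    for f :: "'a \<Rightarrow> real" and w
  proof -
    have "f x = (\<Sum>k<?n. (A k - A (Suc k)) * f (U k))"
      by (subst xU) (simp add: linear_sum[OF f] linear_cmul[OF f])
    also have "\<bar>\<dots>\<bar> \<le> (\<Sum>k<?n. (A k - A (Suc k)) * \<bar>f (U k)\<bar>)"
      using anti by (intro order_trans[OF sum_abs]) (simp add: abs_mult)
    also have "\<dots> \<le> (\<Sum>k<?n. (A k - A (Suc k)) * (\<Sum>i<?n. of_bool (i \<le> k) * w i))"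
      using bound[rule_format, OF layerU] anti by (intro sum_mono mult_left_mono) (simp_all add: less_Suc_eq_le)
    also have "\<dots> = (\<Sum>i<?n. (\<Sum>k<?n. (A k - A (Suc k)) * of_bool (i \<le> k)) * w i)"
      unfolding sum_distrib_left sum_distrib_right by (subst sum.swap) (simp add: mult.assoc)
    also have "\<dots> = (\<Sum>i<?n. A i * w i)" by (intro sum.cong refl) (use tele in simp)
    finally show ?thesis .
  qed
  moreover have "snorm p x = lp p indices A" for p
    unfolding spectral_norm_eq[OF F x] by (rule lp_bij_betw[OF bij]) (simp add: A_def)
  moreover have "0 \<le> A i" for i by (simp add: A_def)
  ultimately have "modulus_sequence x A" unfolding modulus_sequence_def by blast
  have xx: "x \<odot> x = (\<Sum>c\<in>F. (\<phi> c * \<phi> c) *\<^sub>R c)"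
    unfolding x by (rule frame_sum_jprod_sum[OF F])
  have "snorm p (x \<odot> x) = lp p indices (\<lambda>i. A i * A i)" for p
    unfolding spectral_norm_eq[OF F xx] by (rule lp_bij_betw[OF bij]) (simp add: A_def)
  with \<open>modulus_sequence x A\<close> show thesis by (rule that)
qed

text \<open>An empty frame would force \<open>e = 0\<close> and hence a zero algebra, but a
  Euclidean space contains a nonzero basis vector. This keeps the maximum in the infinity-norm
  meaningful.\<close>

lemma frame_nonempty: "jordan_frame (\<odot>) e F \<Longrightarrow> F \<noteq> {}"
proof
  assume "jordan_frame (\<odot>) e F" "F = {}"
  then have "e = 0" using frameD(6) by fastforce
  then have "x = 0" for x :: 'a using unit_jprod[of x] by simp
  then show False by (metis SOME_Basis nonzero_Basis)
qed

lemma indices_nonempty: "indices \<noteq> {}"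
proof -
  obtain F \<phi> where F: "jordan_frame (\<odot>) e F" "e = (\<Sum>c\<in>F. \<phi> c *\<^sub>R c)" using spectral_theorem by blast
  then have "card F \<noteq> 0" using frame_nonempty frameD(1) by auto
  then show ?thesis using card_frame[OF F(1)] by auto
qed

lemmas indices = finite_lessThan[of "jordan_rank (\<odot>) e"] indices_nonempty

lemma inner_eq_inner_unit: "inner x y = inner (x \<odot> y) e"
  using inner_jprod_shift[of x y e] by simp

lemma inner_frame_sums:
  assumes F: "jordan_frame (\<odot>) e F"
  shows "inner (\<Sum>c\<in>F. \<phi> c *\<^sub>R c) (\<Sum>c\<in>F. \<psi> c *\<^sub>R c) = (\<Sum>c\<in>F. \<phi> c * \<psi> c)"
proof -
  have "inner (\<Sum>c\<in>F. (\<phi> c * \<psi> c) *\<^sub>R c) e = (\<Sum>c\<in>F. \<phi> c * \<psi> c)"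
    using inner_primitive_unit frameD(2)[OF F] by (simp add: inner_sum_left)
  then show ?thesis by (subst inner_eq_inner_unit) (simp add: frame_sum_jprod_sum[OF F])
qed

lemma modulus_sequence_bound:
  assumes "modulus_sequence x A" "linear f"
    and "\<And>j u. layer j u \<Longrightarrow> \<bar>f u\<bar> \<le> (\<Sum>i\<in>indices. of_bool (i < j) * w i)"
  shows "\<bar>f x\<bar> \<le> (\<Sum>i\<in>indices. A i * w i)"
  using assms unfolding modulus_sequence_def by blast

text \<open>Needed to treat multiplication by \<open>a\<close> as the polarised form with second
  argument \<open>e\<close>; the unit is itself a layer for the full rank.\<close>

lemma modulus_sequence_unit: "modulus_sequence e (\<lambda>_. 1)"
proof -
  obtain F \<phi> where F: "jordan_frame (\<odot>) e F" "e = (\<Sum>c\<in>F. \<phi> c *\<^sub>R c)" using spectral_theorem by blast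
  have "bij_betw (\<lambda>i. (SOME h. bij_betw h indices F) i) indices F"
    using ex_bij_betw_nat_finite[OF frameD(1)[OF F(1)]] card_frame[OF F(1)]
    by (metis atLeast0LessThan someI_ex)
  moreover have "e = (\<Sum>c\<in>F. 1 *\<^sub>R c)" using frameD(6)[OF F(1)] by simp
  ultimately have "snorm p e = lp p indices (\<lambda>_. 1)" for p
    using spectral_norm_eq[OF F(1), of e "\<lambda>_. 1"] lp_bij_betw[of _ indices F "\<lambda>_. 1" "\<lambda>_. 1"] by metis
  moreover have "\<bar>f e\<bar> \<le> (\<Sum>i\<in>indices. 1 * w i)"
    if "\<forall>j u. layer j u \<longrightarrow> \<bar>f u\<bar> \<le> (\<Sum>i\<in>indices. of_bool (i < j) * w i)" for f :: "'a \<Rightarrow> real" and w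
    using that[rule_format, OF layer_unit] by simp
  ultimately show ?thesis unfolding modulus_sequence_def by (intro conjI allI impI) auto
qed

lemma linear_inner_polar_rep:
  "linear (\<lambda>a. inner (polar_rep a b x) y)" "linear (\<lambda>b. inner (polar_rep a b x) y)"
  "linear (\<lambda>x. inner (polar_rep a b x) y)" "linear (\<lambda>y. inner (polar_rep a b x) y)"
  by (rule linearI; simp add: linear_add[OF linear_polar_rep(1)] linear_cmul[OF linear_polar_rep(1)]
      linear_add[OF linear_polar_rep(2)] linear_cmul[OF linear_polar_rep(2)]
      linear_add[OF linear_polar_rep(3)] linear_cmul[OF linear_polar_rep(3)] inner_simps)+

text \<open>The form is linear in each argument. One argument at a time passes from layers to
  arbitrary elements, and the weights already obtained enter the next application.\<close>

lemma polar_rep_bound: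
  assumes a: "modulus_sequence a A" and b: "modulus_sequence b B"
    and x: "modulus_sequence x X" and y: "modulus_sequence y Y"
  shows "\<bar>inner (polar_rep a b x) y\<bar> \<le> (\<Sum>i\<in>indices. (A i * B i) * X i * Y i)"
proof -
  have 1: "\<bar>inner (polar_rep a b' x') y'\<bar>
      \<le> (\<Sum>i\<in>indices. A i * (of_bool (i < k) * (of_bool (i < l) * of_bool (i < m))))"
    if "layer k b'" "layer l x'" "layer m y'" for k l m b' x' y'
    using polar_rep_layer_bound that by (intro modulus_sequence_bound[OF a linear_inner_polar_rep(1)])
  have 2: "\<bar>inner (polar_rep a b x') y'\<bar>
      \<le> (\<Sum>i\<in>indices. B i * (A i * (of_bool (i < l) * of_bool (i < m))))"
    if "layer l x'" "layer m y'" for l m x' y'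
    using 1 that
    by (intro modulus_sequence_bound[OF b linear_inner_polar_rep(2)])
      (simp only: mult.left_commute[of "of_bool _" "A _"])
  have 3: "\<bar>inner (polar_rep a b x) y'\<bar> \<le> (\<Sum>i\<in>indices. X i * (B i * (A i * of_bool (i < m))))"
    if "layer m y'" for m y'
    using 2 that
    by (intro modulus_sequence_bound[OF x linear_inner_polar_rep(3)])
      (simp only: mult.left_commute[of "of_bool _" "A _"] mult.left_commute[of "of_bool _" "B _"])
  have "\<bar>inner (polar_rep a b x) y\<bar> \<le> (\<Sum>i\<in>indices. Y i * (X i * (B i * A i)))"
    using 3
    by (intro modulus_sequence_bound[OF y linear_inner_polar_rep(4)]) (simp only: mult_ac)
  then show ?thesis by (simp only: mult_ac)
qed

text \<open>Duality: test against an element of a frame diagonalising \<open>z\<close>.\<close>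

lemma spectral_norm_le_if_dual:
  assumes dual: "\<And>c C. modulus_sequence c C \<Longrightarrow> \<bar>inner z c\<bar> \<le> (\<Sum>i\<in>indices. D i * C i)"
    and p: "1 \<le> p"
  shows "snorm p z \<le> lp p indices D"
proof -
  obtain F \<zeta> where F: "jordan_frame (\<odot>) e F" and z: "z = (\<Sum>c\<in>F. \<zeta> c *\<^sub>R c)"
    using spectral_theorem by blast
  note fin = frameD(1)[OF F] and ne = frame_nonempty[OF F]
  have test: "\<bar>\<Sum>c\<in>F. \<zeta> c * \<psi> c\<bar> \<le> lp p indices D * lp q F \<psi>" if q: "1 \<le> q" "1 / 1 = 1 / p + 1 / q" for q \<psi>
  proof -
    let ?c = "\<Sum>c\<in>F. \<psi> c *\<^sub>R c"
    obtain C where C: "modulus_sequence ?c C" using layer_cake by blast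
    have "\<bar>\<Sum>c\<in>F. \<zeta> c * \<psi> c\<bar> = \<bar>inner z ?c\<bar>" by (simp add: z inner_frame_sums[OF F])
    also have "\<dots> \<le> (\<Sum>i\<in>indices. D i * C i)" by (rule dual[OF C])
    also have "\<dots> \<le> (\<Sum>i\<in>indices. \<bar>D i * C i\<bar>)" by (intro sum_mono) simp
    also have "\<dots> = lp 1 indices (\<lambda>i. D i * C i)"
      using lp_real[of 1 indices "\<lambda>i. D i * C i"] by (simp add: one_ereal_def sum_nonneg)
    also have "\<dots> \<le> lp p indices D * lp q indices C"
      using lp_Holder[OF indices _ p q(1), of 1] q by simp
    also have "lp q indices C = lp q F \<psi>"
      using C spectral_norm_eq[OF F refl, of q \<psi>] by (simp add: modulus_sequence_def)
    finally show ?thesis .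
  qed
  have N: "snorm p z = lp p F \<zeta>" by (rule spectral_norm_eq[OF F z])
  show ?thesis
  proof (cases p)
    case PInf
    \<comment> \<open>The test element is the frame member \<open>d\<close> itself, whose 1-norm is
      1.\<close>
    have "\<bar>\<zeta> d\<bar> \<le> lp p indices D" if d: "d \<in> F" for d
    proof -
      have "(\<Sum>c\<in>F. \<zeta> c * (if c = d then 1 else 0)) = (\<Sum>c\<in>F. if c = d then \<zeta> d else 0)"
        by (intro sum.cong) auto
      also have "\<dots> = \<zeta> d" using d fin by simp
      finally show ?thesis
        using test[of 1 "\<lambda>c. if c = d then 1 else 0"] lp_single[OF fin d, of 1 1] PInf by (simp add: one_ereal_def)
    qed
    then show ?thesis unfolding N using lp_infinity_le[OF fin ne] PInf by simp
  next
    case (real p')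
    then have p': "1 \<le> p'" using p by simp
    show ?thesis
    proof (cases "p' = 1")
      case True
      \<comment> \<open>The signs of \<open>\<zeta>\<close> are tested; only an inequality holds, as
        all of them may be zero.\<close>
      have "lp \<infinity> F (\<lambda>c. sgn (\<zeta> c)) \<le> 1"
        by (rule lp_infinity_le[OF fin ne]) (simp add: abs_sgn_eq)
      then have "lp p indices D * lp \<infinity> F (\<lambda>c. sgn (\<zeta> c)) \<le> lp p indices D * 1"
        by (intro mult_left_mono lp_nonneg[OF indices])
      moreover have "lp p F \<zeta> = (\<Sum>c\<in>F. \<zeta> c * sgn (\<zeta> c))"
        by (simp add: real True lp_real sum_nonneg flip: abs_sgn)
      moreover have "\<bar>\<Sum>c\<in>F. \<zeta> c * sgn (\<zeta> c)\<bar> \<le> lp p indices D * lp \<infinity> F (\<lambda>c. sgn (\<zeta> c))"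
        by (rule test) (simp_all add: real True one_ereal_def)
      ultimately show ?thesis unfolding N by simp
    next
      case False
      then have p1: "1 < p'" using p' by simp
      \<comment> \<open>The conjugate exponent. The test coefficients
        \<open>sgn (\<zeta> c) * \<bar>\<zeta> c\<bar> powr (p' - 1)\<close> are the extremal ones
        in the Hoelder inequality, and \<open>(p' - 1) * q = p'\<close> expresses their
        \<open>q\<close>-norm through \<open>Z\<close>.\<close>
      define q where "q = p' / (p' - 1)"
      have q: "1 \<le> q" "1 / 1 = 1 / p' + 1 / q" "(p' - 1) * q = p'" "0 < q"
        using p1 by (simp_all add: q_def field_simps)
      define Z where "Z = (\<Sum>c\<in>F. \<bar>\<zeta> c\<bar> powr p')"
      have "(\<Sum>c\<in>F. \<zeta> c * (sgn (\<zeta> c) * \<bar>\<zeta> c\<bar> powr (p' - 1))) = Z"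
        unfolding Z_def
      proof (intro sum.cong refl)
        fix c
        have "\<zeta> c * (sgn (\<zeta> c) * \<bar>\<zeta> c\<bar> powr (p' - 1)) = \<bar>\<zeta> c\<bar> * \<bar>\<zeta> c\<bar> powr (p' - 1)"
          by (simp add: abs_sgn[of "\<zeta> c"])
        also have "\<dots> = \<bar>\<zeta> c\<bar> powr p'" by (subst powr_mult_base) auto
        finally show "\<zeta> c * (sgn (\<zeta> c) * \<bar>\<zeta> c\<bar> powr (p' - 1)) = \<bar>\<zeta> c\<bar> powr p'" .
      qed
      moreover have "lp (ereal q) F (\<lambda>c. sgn (\<zeta> c) * \<bar>\<zeta> c\<bar> powr (p' - 1)) = Z powr (1 / q)"
      proof -
        have "\<bar>sgn (\<zeta> c) * \<bar>\<zeta> c\<bar> powr (p' - 1)\<bar> powr q = \<bar>\<zeta> c\<bar> powr p'" for c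
          using q by (simp add: abs_mult abs_sgn_eq powr_powr)
        then show ?thesis by (simp add: lp_real Z_def)
      qed
      ultimately have "\<bar>Z\<bar> \<le> lp p indices D * Z powr (1 / q)"
        using test[of "ereal q" "\<lambda>c. sgn (\<zeta> c) * \<bar>\<zeta> c\<bar> powr (p' - 1)"] q real p1 by (simp add: one_ereal_def)
      moreover have "0 \<le> Z" by (simp add: Z_def sum_nonneg)
      ultimately have le: "Z \<le> lp p indices D * Z powr (1 / q)" by simp
      have "Z powr (1 / p') \<le> lp p indices D"
      proof (cases "Z = 0")
        case True
        then show ?thesis using lp_nonneg[OF indices] by simp
      next
        case False
        then have Zp: "0 < Z" using \<open>0 \<le> Z\<close> by simp
        have "1 / p' = 1 - 1 / q" using q(2) by simp
        then have "Z powr (1 / p') = Z / Z powr (1 / q)" using Zp by (simp add: powr_diff)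
        also have "\<dots> \<le> lp p indices D" using le Zp by (simp add: pos_divide_le_eq)
        finally show ?thesis .
      qed
      then show ?thesis unfolding N by (simp add: real lp_real Z_def)
    qed
  qed (use p in auto)
qed

section \<open>Operator norms and their extremal elements\<close>

lemma spectral_norm_zero: "1 \<le> p \<Longrightarrow> snorm p 0 = 0"
proof -
  obtain F \<phi> where F: "jordan_frame (\<odot>) e F" "e = (\<Sum>c\<in>F. \<phi> c *\<^sub>R c)" using spectral_theorem by blast
  have "snorm p 0 = lp p F (\<lambda>_. 0)" by (rule spectral_norm_eq[OF F(1)]) simp
  then show ?thesis using lp_zero[OF frameD(1)[OF F(1)] frame_nonempty[OF F(1)]] by simp
qed

lemma spectral_norm_nonneg: "0 \<le> snorm p x"
proof -
  obtain A where "modulus_sequence x A" using layer_cake by blast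
  then show ?thesis using lp_nonneg[OF indices] by (simp add: modulus_sequence_def)
qed

lemma spectral_op_norm_eqI:
  assumes upper: "\<And>x. snorm s (T x) \<le> K * snorm r x"
    and attained: "snorm s (T x0) = K * snorm r x0" "snorm r x0 \<noteq> 0"
    and "0 \<le> K" "1 \<le> r"
  shows "spectral_op_norm (\<odot>) e r s T = ereal K"
  unfolding spectral_op_norm_def
proof (rule antisym)
  show "(SUP x\<in>{x. x \<noteq> 0}. ereal (snorm s (T x) / snorm r x)) \<le> ereal K"
  proof (rule SUP_least)
    fix x :: 'a
    show "ereal (snorm s (T x) / snorm r x) \<le> ereal K"
    \<comment> \<open>With a vanishing denominator the quotient is 0 by convention, and
      \<open>0 \<le> K\<close> suffices.\<close>
    proof (cases "snorm r x = 0")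
      case False
      then have "0 < snorm r x" using spectral_norm_nonneg[of r x] by simp
      then show ?thesis using upper by (simp add: pos_divide_le_eq)
    qed (use assms in simp)
  qed
  have "x0 \<noteq> 0" using attained spectral_norm_zero assms by auto
  moreover have "snorm s (T x0) / snorm r x0 = K" using attained by simp
  ultimately show "ereal K \<le> (SUP x\<in>{x. x \<noteq> 0}. ereal (snorm s (T x) / snorm r x))"
    by (metis (mono_tags, lifting) SUP_upper mem_Collect_eq)
qed

text \<open>Common to both parts, with \<open>g\<close> either \<open>a\<close> or its square.
  Duality gives the upper bounds from scalar inequalities for \<open>G\<close>. On elements diagonal
  in \<open>F\<close> the map \<open>T\<close> multiplies coefficients by those of \<open>g\<close>,
  so the scalar extremal vectors attain the bounds.\<close>

lemma diagonal_operator_norms: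
  assumes bound: "\<And>b B c C. modulus_sequence b B \<Longrightarrow> modulus_sequence c C \<Longrightarrow>
      \<bar>inner (T b) c\<bar> \<le> (\<Sum>i\<in>indices. G i * B i * C i)"
    and G: "\<And>p. snorm p g = lp p indices G"
    and F: "jordan_frame (\<odot>) e F" and g: "g = (\<Sum>c\<in>F. \<phi> c *\<^sub>R c)"
    and T: "\<And>\<psi>. T (\<Sum>c\<in>F. \<psi> c *\<^sub>R c) = (\<Sum>c\<in>F. (\<phi> c * \<psi> c) *\<^sub>R c)"
    and rs: "1 \<le> r" "1 \<le> s"
  shows "1 \<le> p \<Longrightarrow> 1 / p = 1 / r + 1 / s \<Longrightarrow> snorm p (T b) \<le> snorm r g * snorm s b"
    and "spectral_op_norm (\<odot>) e r s T =
      ereal (if r \<le> s then snorm \<infinity> g else snorm (quotient_exponent r s) g)"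
proof -
  note fin = frameD(1)[OF F] and ne = frame_nonempty[OF F]
  have le: "snorm p (T b) \<le> lp p indices (\<lambda>i. G i * B i)" if "modulus_sequence b B" "1 \<le> p" for p b B
    by (rule spectral_norm_le_if_dual[OF _ that(2)]) (rule bound[OF that(1)])
  have N: "snorm p (\<Sum>c\<in>F. \<psi> c *\<^sub>R c) = lp p F \<psi>" for p \<psi>
    by (rule spectral_norm_eq[OF F refl])
  have NT: "snorm p (T (\<Sum>c\<in>F. \<psi> c *\<^sub>R c)) = lp p F (\<lambda>c. \<phi> c * \<psi> c)" for p \<psi>
    unfolding T by (rule N)
  have Ng: "snorm p g = lp p F \<phi>" for p unfolding g by (rule N)
  show "snorm p (T b) \<le> snorm r g * snorm s b" if "1 \<le> p" "1 / p = 1 / r + 1 / s"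
  proof -
    obtain B where B: "modulus_sequence b B" using layer_cake by blast
    have "snorm p (T b) \<le> lp p indices (\<lambda>i. G i * B i)" by (rule le[OF B that(1)])
    also have "\<dots> \<le> lp r indices G * lp s indices B" by (rule lp_Holder[OF indices that(1) rs that(2)])
    finally show ?thesis using B G by (simp add: modulus_sequence_def)
  qed
  show "spectral_op_norm (\<odot>) e r s T =
      ereal (if r \<le> s then snorm \<infinity> g else snorm (quotient_exponent r s) g)"
  proof (cases "r \<le> s")
    case True
    have upper: "snorm s (T x) \<le> snorm \<infinity> g * snorm r x" for x
    proof -
      obtain X where X: "modulus_sequence x X" using layer_cake by blast
      have "snorm s (T x) \<le> lp s indices (\<lambda>i. G i * X i)" by (rule le[OF X rs(2)])
      also have "\<dots> \<le> lp \<infinity> indices G * lp s indices X" by (rule lp_mult_left[OF indices rs(2)])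
      also have "\<dots> \<le> lp \<infinity> indices G * lp r indices X"
        by (intro mult_left_mono lp_antimono[OF indices rs(1) True] lp_nonneg[OF indices])
      finally show ?thesis using X G by (simp add: modulus_sequence_def)
    qed
    \<comment> \<open>The norm is attained at a frame member whose coefficient in \<open>g\<close>
      has the largest modulus.\<close>
    have "lp \<infinity> F \<phi> \<in> (\<lambda>c. \<bar>\<phi> c\<bar>) ` F" unfolding lp_def using fin ne by (simp add: Max_in)
    then obtain d where d: "d \<in> F" "snorm \<infinity> g = \<bar>\<phi> d\<bar>" unfolding Ng by blast
    let ?x = "\<Sum>c\<in>F. (if c = d then 1 else 0) *\<^sub>R c"
    have x: "snorm r ?x = 1" unfolding N by (simp add: lp_single[OF fin d(1) rs(1)])
    have "(\<lambda>c. \<phi> c * (if c = d then 1 else 0)) = (\<lambda>c. if c = d then \<phi> d else 0)" by auto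
    then have "snorm s (T ?x) = \<bar>\<phi> d\<bar>" unfolding NT by (simp add: lp_single[OF fin d(1) rs(2)])
    then have "spectral_op_norm (\<odot>) e r s T = ereal (snorm \<infinity> g)"
      using x d(2) spectral_norm_nonneg by (intro spectral_op_norm_eqI[OF upper, of ?x] rs) auto
    then show ?thesis using True by simp
  next
    case False
    then obtain s' where s': "s = ereal s'" "1 \<le> s'" using rs by (cases s) auto
    \<comment> \<open>The unit, written in the frame; it is extremal for infinite
      \<open>r\<close>.\<close>
    let ?e = "\<Sum>c\<in>F. 1 *\<^sub>R c"
    show ?thesis
    proof (cases "r = \<infinity>")
      case True
      have upper: "snorm s (T x) \<le> snorm s g * snorm r x" for x
      proof -
        obtain X where X: "modulus_sequence x X" using layer_cake by blast
        have "snorm s (T x) \<le> lp s indices (\<lambda>i. G i * X i)" by (rule le[OF X rs(2)])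
        also have "\<dots> \<le> lp s indices G * lp \<infinity> indices X" by (rule lp_mult_right[OF indices rs(2)])
        finally show ?thesis using X G True by (simp add: modulus_sequence_def)
      qed
      have "lp \<infinity> F (\<lambda>_. 1) = 1" using ne fin by (simp add: lp_def)
      then have "snorm r ?e = 1" unfolding N True .
      moreover have "snorm s (T ?e) = snorm s g" unfolding NT Ng by simp
      ultimately have "spectral_op_norm (\<odot>) e r s T = ereal (snorm s g)"
        using spectral_norm_nonneg by (intro spectral_op_norm_eqI[OF upper, of ?e] rs) auto
      then show ?thesis using False True by (simp add: quotient_exponent_def)
    next
      case rfin: False
      then obtain r' where r': "r = ereal r'" "1 \<le> r'" using rs by (cases r) auto
      have sr: "s' < r'" using False r' s' by simp
      define t where "t = r' * s' / (r' - s')"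
      have t: "0 < t" "1 / s' = 1 / t + 1 / r'"
        using sr r' s' by (simp_all add: t_def field_simps)
      have q: "quotient_exponent r s = ereal t"
        using sr r' s' by (simp add: quotient_exponent_def t_def)
      let ?K = "snorm (ereal t) g"
      have upper: "snorm s (T x) \<le> ?K * snorm r x" for x
      proof -
        obtain X where X: "modulus_sequence x X" using layer_cake by blast
        have "snorm s (T x) \<le> lp s indices (\<lambda>i. G i * X i)" by (rule le[OF X rs(2)])
        also have "\<dots> \<le> lp (ereal t) indices G * lp r indices X"
          unfolding s' r' using s' r' t by (intro lp_Holder_real[OF indices(1)]) auto
        finally show ?thesis using X G by (simp add: modulus_sequence_def)
      qed
      define Z where "Z = (\<Sum>c\<in>F. \<bar>\<phi> c\<bar> powr t)"
      have K: "?K = Z powr (1 / t)" unfolding Ng lp_real Z_def ..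
      have "spectral_op_norm (\<odot>) e r s T = ereal ?K"
      proof (cases "Z = 0")
        \<comment> \<open>All coefficients of \<open>g\<close> vanish, so the extremal vector of the
          other case would be zero; the unit serves instead.\<close>
        case True
        then have \<phi>0: "\<phi> c = 0" if "c \<in> F" for c
          using that fin by (auto simp: Z_def sum_nonneg_eq_0_iff)
        have "snorm s (T ?e) = 0" unfolding NT by (rule lp_zero[OF fin ne]) (simp add: \<phi>0)
        moreover have "snorm r ?e \<noteq> 0" unfolding N r' lp_real using fin ne by simp
        moreover have "?K = 0" using K True by simp
        ultimately show ?thesis by (intro spectral_op_norm_eqI[OF upper, of ?e] rs) auto
      next
        case False
        then have Z: "0 < Z" by (simp add: Z_def sum_nonneg less_le)
        \<comment> \<open>Equality in the Hoelder inequality needs the \<open>r'\<close>-th powers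
          of the coefficients proportional to the \<open>t\<close>-th powers of those of
          \<open>g\<close>. Both power sums then equal \<open>Z\<close>, and
          \<open>1 / s' = 1 / t + 1 / r'\<close> splits its exponent.\<close>
        let ?x = "\<Sum>c\<in>F. (\<bar>\<phi> c\<bar> powr (t / r')) *\<^sub>R c"
        have x: "snorm r ?x = Z powr (1 / r')"
          unfolding N r' lp_real Z_def using r' by (simp add: powr_powr)
        have "(1 + t / r') * s' = t" using t s' r'
          by (simp add: t_def field_simps) (use sr in \<open>simp add: field_simps\<close>)
        moreover have "\<bar>\<phi> c * \<bar>\<phi> c\<bar> powr (t / r')\<bar> = \<bar>\<phi> c\<bar> powr (1 + t / r')" for c
          by (simp add: abs_mult powr_mult_base)
        ultimately have "snorm s (T ?x) = Z powr (1 / s')"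
          unfolding NT s' lp_real Z_def by (simp add: powr_powr)
        also have "\<dots> = ?K * snorm r ?x" unfolding K x t(2) by (simp add: powr_add)
        finally show ?thesis
          using x Z spectral_norm_nonneg by (intro spectral_op_norm_eqI[OF upper, of ?x] rs) auto
      qed
      then show ?thesis using False q by simp
    qed
  qed
qed

end

section \<open>Specialisation to multiplication by \<open>a\<close> and to the quadratic
  representation\<close>

theorem corollary5p2:
  fixes jprod :: "'a::euclidean_space \<Rightarrow> 'a \<Rightarrow> 'a" (infixl "\<odot>" 70)
    and e a b :: 'a
    and n :: nat
    and p r s :: ereal
  assumes "euclidean_jordan_algebra (\<odot>) e"
    and "\<And>x y. inner x y = jordan_trace (\<odot>) e (x \<odot> y)"
    and "jordan_rank (\<odot>) e = n"
    and "1 \<le> p" and "1 \<le> r" and "1 \<le> s"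
    and "1 / p = 1 / r + 1 / s"
  shows "(spectral_norm (\<odot>) e p (a \<odot> b)
            \<le> spectral_norm (\<odot>) e r a * spectral_norm (\<odot>) e s b
          \<and> spectral_op_norm (\<odot>) e r s (lyapunov (\<odot>) a) =
              ereal (if r \<le> s then spectral_norm (\<odot>) e \<infinity> a
                     else spectral_norm (\<odot>) e (quotient_exponent r s) a))
       \<and> (spectral_norm (\<odot>) e p (quadratic_rep (\<odot>) a b)
            \<le> spectral_norm (\<odot>) e r (a \<odot> a) * spectral_norm (\<odot>) e s b
          \<and> spectral_op_norm (\<odot>) e r s (quadratic_rep (\<odot>) a) =
              ereal (if r \<le> s then spectral_norm (\<odot>) e \<infinity> (a \<odot> a)
                     else spectral_norm (\<odot>) e (quotient_exponent r s) (a \<odot> a)))"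
proof -
  interpret euclidean_jordan_algebra_trace "(\<odot>)" e
    using assms(1,2) by (simp add: euclidean_jordan_algebra_trace_def euclidean_jordan_algebra_trace_axioms_def)
  obtain A where A: "modulus_sequence a A" "\<And>p. snorm p (a \<odot> a) = lp p indices (\<lambda>i. A i * A i)"
    using layer_cake by blast
  obtain F \<phi> where F: "jordan_frame (\<odot>) e F" and a: "a = (\<Sum>c\<in>F. \<phi> c *\<^sub>R c)"
    using spectral_theorem by blast
  have aa: "a \<odot> a = (\<Sum>c\<in>F. (\<phi> c * \<phi> c) *\<^sub>R c)" unfolding a by (rule frame_sum_jprod_sum[OF F])
  have L: "\<bar>inner (lyapunov (\<odot>) a b) c\<bar> \<le> (\<Sum>i\<in>indices. A i * B i * C i)"
    if "modulus_sequence b B" "modulus_sequence c C" for b B c C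
    using polar_rep_bound[OF A(1) modulus_sequence_unit that] by (simp add: polar_rep_unit)
  have P: "\<bar>inner (quadratic_rep (\<odot>) a b) c\<bar> \<le> (\<Sum>i\<in>indices. A i * A i * B i * C i)"
    if "modulus_sequence b B" "modulus_sequence c C" for b B c C
    using polar_rep_bound[OF A(1) A(1) that] by (simp add: polar_rep_same)
  have NA: "snorm p a = lp p indices A" for p using A(1) by (simp add: modulus_sequence_def)
  have TL: "lyapunov (\<odot>) a (\<Sum>c\<in>F. \<psi> c *\<^sub>R c) = (\<Sum>c\<in>F. (\<phi> c * \<psi> c) *\<^sub>R c)" for \<psi>
    unfolding lyapunov_def a by (rule frame_sum_jprod_sum[OF F])
  have TP: "quadratic_rep (\<odot>) a (\<Sum>c\<in>F. \<psi> c *\<^sub>R c) = (\<Sum>c\<in>F. (\<phi> c * \<phi> c * \<psi> c) *\<^sub>R c)" for \<psi>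
    unfolding quadratic_rep_def aa unfolding a
    by (simp add: frame_sum_jprod_sum[OF F] scaleR_2 mult.assoc)
  \<comment> \<open>The first two rules take \<open>g = a\<close> with sequence \<open>A\<close>,
    the last two the square of \<open>a\<close> with the squares of \<open>A\<close>.\<close>
  note rules = diagonal_operator_norms[OF _ NA F a TL assms(5,6)] diagonal_operator_norms[OF _ A(2) F aa TP assms(5,6)]
  have "snorm p (lyapunov (\<odot>) a b) \<le> snorm r a * snorm s b"
    by (rule rules(1)[OF _ assms(4,7)]) (rule L)
  moreover have "spectral_op_norm (\<odot>) e r s (lyapunov (\<odot>) a) =
      ereal (if r \<le> s then snorm \<infinity> a else snorm (quotient_exponent r s) a)"
    by (rule rules(2)) (rule L)
  moreover have "snorm p (quadratic_rep (\<odot>) a b) \<le> snorm r (a \<odot> a) * snorm s b"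
    by (rule rules(3)[OF _ assms(4,7)]) (rule P)
  moreover have "spectral_op_norm (\<odot>) e r s (quadratic_rep (\<odot>) a) =
      ereal (if r \<le> s then snorm \<infinity> (a \<odot> a) else snorm (quotient_exponent r s) (a \<odot> a))"
    by (rule rules(4)) (rule P)
  ultimately show ?thesis by (simp only: lyapunov_def simp_thms)
qed

end
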